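(* Let $d\ge3$ and consider a $d$-dimensional random walk with internal states satisfying the basic assumptions (i)–(iv). Assume that $\varepsilon_0$ is distributed according to the stationary measure $\mu$. Then $$V_d(n)=O\left(n^{1+\frac2d}\right)\qquad(n\to\infty).$$
   Context: Random walk with internal states (RWwIS). $E=\{1,\dots,s\}$ is a finite set, $d\ge1$, and $p_{y,j,k}\ge 0$ ($y\in\mathbb{Z}^d$, $j,k\in E$) satisfy $\sum_{y,k}p_{y,j,k}=1$ for each $j$. The RWwIS is the Markov chain $\xi_n=(\eta_n,\varepsilon_n)$ on $\mathbb{Z}^d\times E$ with $P(\xi_{n+1}=(x',k)\mid \xi_n=(x,j))=p_{x'-x,j,k}$; we start from $\eta_0=0$. Put $A_y=(p_{y,j,k})_{j,k}$, $Q=\sum_y A_y$, $M_l=\sum_y y_lA_y$, $\Sigma_{l,m}=\sum_y y_ly_mA_y$, $\underline{1}=(1,\dots,1)^T\in\mathbb{R}^s$. Basic assumptions: (i) the Markov chain $(\varepsilon_n)$ on $E$, whose transition matrix is $Q$, is irreducible and aperiodic; $\mu$ is its unique stationary distribution. (ii) Trivial arithmetic: for $j\in E$ the subgroup of $\mathbb{Z}^d$ generated by all differences $y-y'$ such that for some $n\geq 1$ both $P(\xi_n=(y,j)\mid\xi_0=(0,j))>0$ and $P(\xi_n=(y',j)\mid\xi_0=(0,j))>0$ is $\mathbb{Z}^d$. (iii) Zero mean: $\langle\mu,M_l\underline{1}\rangle=0$ for all $l$. (iv) The second moments $\sum_y\|y\|^2A_y$ converge and the covariance matrix $\sigma=(\sigma_{l,m})_{1\le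 l,m\le d}$, $\sigma_{l,m}=\langle\mu,\Sigma_{l,m}\underline{1}\rangle-\langle\mu,M_l(Q-1)^{-1}M_m\underline{1}\rangle-\langle\mu,M_m(Q-1)^{-1}M_l\underline{1}\rangle$, is nonsingular (positive definite); here $(Q-1)^{-1}M_m\underline{1}$ is the unique vector $v$ with $\langle\mu,v\rangle=0$ and $Qv-v=M_m\underline{1}$. $L_d(n)=\#\{\eta_0,\dots,\eta_n\}$ is the number of distinct sites visited up to $n$ steps, and $V_d(n)$ is its variance. *)

theory Defs
  imports
    "HOL-Probability.Probability"
    "HOL-Computational_Algebra.Group_Closure"
    "HOL-Library.Landau_Symbols"
begin

text \<open>
  The lattice is \<open>int ^ 'd\<close> with dimension \<open>CARD('d)\<close>; the set of internal states is the finite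
  type \<open>'s\<close>. The kernel \<open>p y j k\<close> is the probability of jumping by \<open>y\<close> while the internal
  state changes from \<open>j\<close> to \<open>k\<close>.
\<close>

type_synonym ('d, 's) kernel = "int ^ 'd \<Rightarrow> 's \<Rightarrow> 's \<Rightarrow> real"

definition rwwis_kernel :: "('d::finite, 's::finite) kernel \<Rightarrow> bool" where
  "rwwis_kernel p \<longleftrightarrow>
     (\<forall>y j k. 0 \<le> p y j k) \<and> (\<forall>j. ((\<lambda>(y, k). p y j k) has_sum 1) UNIV)"

definition rwwis ::
  "('d::finite, 's::finite) kernel \<Rightarrow> 'w measure \<Rightarrow> (nat \<Rightarrow> 'w \<Rightarrow> (int ^ 'd) \<times> 's) \<Rightarrow> bool" where
  "rwwis p M \<xi> \<longleftrightarrow>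
     prob_space M \<and>
     (\<forall>n. \<xi> n \<in> M \<rightarrow>\<^sub>M count_space UNIV) \<and>
     (\<forall>n h x k. \<P>(\<omega> in M. \<forall>i\<le>n. \<xi> i \<omega> = h i) > 0 \<longrightarrow>
        \<P>(\<omega> in M. \<xi> (Suc n) \<omega> = (x, k) \<bar> \<forall>i\<le>n. \<xi> i \<omega> = h i)
          = p (x - fst (h n)) (snd (h n)) k) \<and>
     (AE \<omega> in M. fst (\<xi> 0 \<omega>) = 0)"

definition A_mat :: "('d::finite, 's::finite) kernel \<Rightarrow> int ^ 'd \<Rightarrow> real ^ 's ^ 's" where
  "A_mat p y = (\<chi> j k. p y j k)"

definition Q_mat :: "('d::finite, 's::finite) kernel \<Rightarrow> real ^ 's ^ 's" where
  "Q_mat p = (\<Sum>\<^sub>\<infinity>y. A_mat p y)"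

definition M_mat :: "('d::finite, 's::finite) kernel \<Rightarrow> 'd \<Rightarrow> real ^ 's ^ 's" where
  "M_mat p l = (\<Sum>\<^sub>\<infinity>y. real_of_int (y $ l) *\<^sub>R A_mat p y)"

definition Sigma_mat :: "('d::finite, 's::finite) kernel \<Rightarrow> 'd \<Rightarrow> 'd \<Rightarrow> real ^ 's ^ 's" where
  "Sigma_mat p l m = (\<Sum>\<^sub>\<infinity>y. (real_of_int (y $ l) * real_of_int (y $ m)) *\<^sub>R A_mat p y)"

text \<open>The operation \<open>^\<close> on \<open>real ^ 's ^ 's\<close> is not the power for the matrix product.\<close>

definition matrix_power :: "real ^ 's ^ 's \<Rightarrow> nat \<Rightarrow> real ^ 's ^ ('s::finite)" where
  "matrix_power B n = ((\<lambda>C. B ** C) ^^ n) (mat 1)"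

definition irreducible_matrix :: "real ^ 's ^ ('s::finite) \<Rightarrow> bool" where
  "irreducible_matrix B \<longleftrightarrow> (\<forall>j k. \<exists>n. matrix_power B n $ j $ k > 0)"

definition aperiodic_matrix :: "real ^ 's ^ ('s::finite) \<Rightarrow> bool" where
  "aperiodic_matrix B \<longleftrightarrow> (\<forall>j. Gcd {n. n \<ge> 1 \<and> matrix_power B n $ j $ j > 0} = 1)"

definition stationary_distribution :: "real ^ 's ^ ('s::finite) \<Rightarrow> real ^ 's \<Rightarrow> bool" where
  "stationary_distribution B \<mu> \<longleftrightarrow>
     (\<forall>j. 0 \<le> \<mu> $ j) \<and> (\<Sum>j\<in>UNIV. \<mu> $ j) = 1 \<and> \<mu> v* B = \<mu>"

text \<open>
  \<open>step_prob p n y j k\<close> is the probability of being in state \<open>(y, k)\<close> at time \<open>n\<close> when started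
  from \<open>(0, j)\<close>.
\<close>

primrec step_prob :: "('d::finite, 's::finite) kernel \<Rightarrow> nat \<Rightarrow> ('d, 's) kernel" where
  "step_prob p 0 = (\<lambda>y j k. if y = 0 \<and> k = j then 1 else 0)"
| "step_prob p (Suc n) =
     (\<lambda>y j k. \<Sum>\<^sub>\<infinity>(z, i). step_prob p n z j i * p (y - z) i k)"

definition trivial_arithmetic :: "('d::finite, 's::finite) kernel \<Rightarrow> bool" where
  "trivial_arithmetic p \<longleftrightarrow>
     (\<forall>j. group_closure
        {y - y' | y y'. \<exists>n\<ge>1. step_prob p n y j j > 0 \<and> step_prob p n y' j j > 0} = UNIV)"

definition zero_mean :: "('d::finite, 's::finite) kernel \<Rightarrow> real ^ 's \<Rightarrow> bool" where
  "zero_mean p \<mu> \<longleftrightarrow> (\<forall>l. \<mu> \<bullet> (M_mat p l *v 1) = 0)"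

definition finite_second_moments :: "('d::finite, 's::finite) kernel \<Rightarrow> bool" where
  "finite_second_moments p \<longleftrightarrow>
     (\<lambda>y. (norm (\<chi> i. real_of_int (y $ i) :: real ^ 'd))\<^sup>2 *\<^sub>R A_mat p y) summable_on UNIV"

text \<open>
  The inverse of \<open>Q - 1\<close> on the vectors orthogonal to \<open>\<mu>\<close>; the solution \<open>v\<close> exists and is unique
  when \<open>Q\<close> is an irreducible stochastic matrix with stationary distribution \<open>\<mu>\<close> and \<open>\<mu> \<bullet> w = 0\<close>.
\<close>

definition Q_minus_one_inv :: "('d::finite, 's::finite) kernel \<Rightarrow> real ^ 's \<Rightarrow> real ^ 's \<Rightarrow> real ^ 's" where
  "Q_minus_one_inv p \<mu> w = (THE v. \<mu> \<bullet> v = 0 \<and> Q_mat p *v v - v = w)"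

definition covariance_matrix :: "('d::finite, 's::finite) kernel \<Rightarrow> real ^ 's \<Rightarrow> real ^ 'd ^ 'd" where
  "covariance_matrix p \<mu> = (\<chi> l m.
      \<mu> \<bullet> (Sigma_mat p l m *v 1)
      - \<mu> \<bullet> (M_mat p l *v Q_minus_one_inv p \<mu> (M_mat p m *v 1))
      - \<mu> \<bullet> (M_mat p m *v Q_minus_one_inv p \<mu> (M_mat p l *v 1)))"

definition visited_sites :: "(nat \<Rightarrow> 'w \<Rightarrow> (int ^ 'd) \<times> 's) \<Rightarrow> nat \<Rightarrow> 'w \<Rightarrow> nat" where
  "visited_sites \<xi> n \<omega> = card ((\<lambda>i. fst (\<xi> i \<omega>)) ` {..n})"

end

theory Submission
  imports Defs "HOL-Library.Discrete_Functions"
begin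

text \<open>
  A site visited up to time \<open>n\<close> has exactly one last visit, so \<open>L_d(n)\<close> is the sum over
  \<open>i \<le> n\<close> of the indicators \<open>Y_i\<close> that the walk does not return to its current site during
  \<open>{i<..n}\<close>. Each \<open>Y_i\<close> is compared with the indicator \<open>W_i\<close> that there is no return during
  the \<open>m\<close> steps after time \<open>i\<close>, and the two sources of variance are balanced by the choice of \<open>m\<close>.

  The variance of the sum of the \<open>W_i\<close> is of order \<open>n m\<close>. Indeed \<open>W_i\<close> depends only on the path
  up to time \<open>i + m\<close>. By translation invariance the conditional expectation of a later \<open>W_j\<close> given that
  path is a function of the internal state at time \<open>i + m\<close>, and this function is constant up to an
  error summable in \<open>j - i - m\<close>, because some power of the irreducible aperiodic matrix \<open>Q\<close> is positive
  (Doeblin). Hence for each \<open>i\<close> only about \<open>m\<close> of the covariances matter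
  (\<open>mixing_rate\<close>, \<open>covariance_no_early_return_le\<close>, \<open>variance_truncated_le\<close>).

  The error \<open>D\<close> of the truncation satisfies \<open>\<bar>D\<bar> \<le> n + 1\<close>, so its second moment is at most
  \<open>n + 1\<close> times the expected number of indices \<open>i\<close> at which \<open>Y_i\<close> and \<open>W_i\<close> differ. The latter
  is controlled by the probability of a return after more than \<open>m\<close> steps. Since the walk is at a given
  site at time \<open>k\<close> with probability \<open>O(k^(-d/2))\<close> (\<open>local_limit_upper_bound\<close>) and \<open>d \<ge> 3\<close>, this
  probability is \<open>O(m^(1-d/2))\<close>, and the second moment is \<open>O(n m + n^2 m^(1-d/2))\<close>
  (\<open>expectation_truncation_error_squared_le\<close>). With \<open>m\<close> of order \<open>n^(2/d)\<close> all the terms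
  have order \<open>n^(1+2/d)\<close>.

  The bound \<open>O(k^(-d/2))\<close> comes from the characteristic function. If two loops at an internal
  state \<open>j\<close> have the same length and displacements \<open>y\<close>, \<open>y'\<close>, their contributions interfere
  in the transform at the frequency \<open>t\<close>, which costs a factor
  \<open>1 - c sin^2(\<langle>t, y - y'\<rangle> / 2)\<close> over a long block of steps. The vectors that give such a factor form
  a group, so the trivial arithmetic yields all unit vectors, and over one block the transform contracts by
  \<open>1 - c \<Sum>\<^sub>l sin^2(t_l / 2)\<close> (\<open>uniformly_damped\<close>). Over \<open>k\<close> steps this is Gaussian
  decay. Reducing the walk modulo an integer of order \<open>\<surd>k\<close>, which can only increase point masses,
  turns the Fourier inversion into a finite average over frequencies, and that average factorises over the
  coordinates (\<open>point_mass_le_average_over_frequencies\<close>).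
\<close>

section \<open>Bounded expectations under discrete laws\<close>

lemma integrable_pmf_bounded:
  fixes f :: "'a \<Rightarrow> 'b::{banach, second_countable_topology}"
  assumes "\<And>x. norm (f x) \<le> B"
  shows "integrable (measure_pmf P) f"
  by (rule measure_pmf.integrable_const_bound[where B = B]) (auto simp: assms)

lemma norm_integral_pmf_le:
  fixes f :: "'a \<Rightarrow> 'b::{banach, second_countable_topology}"
  assumes "\<And>x. norm (f x) \<le> B"
  shows "norm (\<integral>x. f x \<partial>measure_pmf P) \<le> B"
proof -
  have "0 \<le> B"
    using assms norm_ge_zero order_trans by blast
  have "norm (\<integral>x. f x \<partial>measure_pmf P) \<le> (\<integral>x. norm (f x) \<partial>measure_pmf P)"
    by (rule integral_norm_bound)
  also have "\<dots> \<le> (\<integral>x. B \<partial>measure_pmf P)"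
    using assms by (intro integral_mono integrable_norm integrable_pmf_bounded[where B = B])
      (auto simp: \<open>0 \<le> B\<close>)
  finally show ?thesis by simp
qed

lemma integral_bind_pmf_real:
  fixes f :: "'b \<Rightarrow> real"
  assumes "\<And>x. \<bar>f x\<bar> \<le> B"
  shows "(\<integral>y. f y \<partial>bind_pmf P N) = (\<integral>x. \<integral>y. f y \<partial>N x \<partial>P)"
  unfolding measure_pmf_bind
  by (rule integral_bind[where K = "count_space UNIV" and B = B and B' = 1])
     (auto simp: assms measure_pmf.finite_measure_axioms measure_pmf.emeasure_space_1 measure_pmf_in_subprob_algebra)

lemma integral_bind_pmf_complex:
  fixes f :: "'b \<Rightarrow> complex"
  assumes "\<And>x. norm (f x) \<le> B"
  shows "(\<integral>y. f y \<partial>bind_pmf P N) = (\<integral>x. \<integral>y. f y \<partial>N x \<partial>P)"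
proof -
  have int: "integrable (measure_pmf R) f" for R
    by (rule integrable_pmf_bounded[OF assms])
  have int': "integrable (measure_pmf P) (\<lambda>x. \<integral>y. f y \<partial>N x)"
    by (rule integrable_pmf_bounded[where B = B]) (rule norm_integral_pmf_le[OF assms])
  have "\<bar>Re (f x)\<bar> \<le> B" "\<bar>Im (f x)\<bar> \<le> B" for x
    using assms[of x] abs_Re_le_cmod[of "f x"] abs_Im_le_cmod[of "f x"] by auto
  note re = integral_bind_pmf_real[OF this(1)] and im = integral_bind_pmf_real[OF this(2)]
  show ?thesis
    by (rule complex_eqI) (simp_all add: re im flip: integral_Re[OF int] integral_Im[OF int]
        integral_Re[OF int'] integral_Im[OF int'])
qed

section \<open>Random walks with internal states\<close>

definition translate :: "int ^ 'd \<Rightarrow> (int ^ 'd) \<times> 's \<Rightarrow> (int ^ 'd) \<times> 's" where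
  "translate z s = (z + fst s, snd s)"

text \<open>
  The walk is described by the laws \<open>K j\<close> of the pair (displacement, new internal state) in
  the internal state \<open>j\<close>. All these laws are discrete, so they are taken as \<open>pmf\<close>s,
  for which every bounded function is integrable.
\<close>

definition jump :: "('s \<Rightarrow> ((int ^ 'd) \<times> 's) pmf) \<Rightarrow> (int ^ 'd) \<times> 's \<Rightarrow> ((int ^ 'd) \<times> 's) pmf" where
  "jump K s = map_pmf (translate (fst s)) (K (snd s))"

primrec walk :: "('s \<Rightarrow> ((int ^ 'd) \<times> 's) pmf) \<Rightarrow> nat \<Rightarrow> (int ^ 'd) \<times> 's \<Rightarrow> ((int ^ 'd) \<times> 's) pmf" where
  "walk K 0 s = return_pmf s"
| "walk K (Suc n) s = bind_pmf (walk K n s) (jump K)"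

lemma fst_translate [simp]: "fst (translate z s) = z + fst s"
  and snd_translate [simp]: "snd (translate z s) = snd s"
  by (simp_all add: translate_def)

lemma translate_origin: "translate (fst s) (0, snd s) = s"
  by (simp add: translate_def)

lemma jump_translate: "jump K (translate z s) = map_pmf (translate z) (jump K s)"
  by (simp add: jump_def map_pmf_comp translate_def[abs_def] add.assoc)

lemma walk_translate: "walk K n (translate z s) = map_pmf (translate z) (walk K n s)"
  by (induction n) (simp_all add: bind_map_pmf map_bind_pmf jump_translate)

text \<open>
  Translation invariance: only the internal state of the starting point matters, so an estimate that is
  uniform in the starting point follows from the finitely many cases \<open>(0, j)\<close>.
\<close>

lemma walk_from_origin: "walk K n s = map_pmf (translate (fst s)) (walk K n (0, snd s))"
  using walk_translate[of K n "fst s" "(0, snd s)"] by (simp add: translate_origin)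

lemma walk_add: "walk K (m + n) s = bind_pmf (walk K m s) (walk K n)"
  by (induction n) (simp_all add: bind_return_pmf' bind_assoc_pmf)

section \<open>Mixing of the internal states\<close>

definition leads_to :: "('s \<Rightarrow> ((int ^ 'd) \<times> 's) pmf) \<Rightarrow> nat \<Rightarrow> 's \<Rightarrow> int ^ 'd \<Rightarrow> 's \<Rightarrow> bool" where
  "leads_to K n i x j \<longleftrightarrow> (x, j) \<in> set_pmf (walk K n (0, i))"

lemma leads_to_add:
  assumes "leads_to K m i x j" "leads_to K n j y k"
  shows "leads_to K (m + n) i (x + y) k"
proof -
  have "(x + y, k) \<in> set_pmf (walk K n (x, j))"
    using assms(2) unfolding leads_to_def
    by (subst walk_from_origin) (force simp: translate_def)
  with assms(1) show ?thesis
    by (force simp: leads_to_def walk_add)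
qed

text \<open>
  The group generated by \<open>S\<close> contains 1, so that \<open>S \<union> {0}\<close> contains two consecutive numbers
  \<open>y\<close> and \<open>y + 1\<close>. From \<open>y\<^sup>2\<close> on, every number is a sum of copies of these two.
\<close>

lemma numerical_semigroup_cofinite:
  fixes S :: "nat set"
  assumes add: "\<And>x y. x \<in> S \<Longrightarrow> y \<in> S \<Longrightarrow> x + y \<in> S"
    and gcd: "Gcd S = 1"
  shows "\<forall>\<^sub>F n in sequentially. n \<in> S"
proof -
  define T where "T = insert 0 S"
  have T_add: "x + y \<in> T" if "x \<in> T" "y \<in> T" for x y
    using that add by (auto simp: T_def)
  have T_mult: "k * x \<in> T" if "x \<in> T" for k x
    using that by (induction k) (simp_all add: T_add, simp add: T_def)
  have diff: "\<exists>x\<in>T. \<exists>y\<in>T. a = int x - int y" if "a \<in> group_closure (int ` S)" for a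
    using that
  proof (induction rule: group_closure.induct)
    case (base s)
    then show ?case
      by (auto simp: T_def)
  next
    case (diff s t)
    then obtain x y x' y' where "x \<in> T" "y \<in> T" "s = int x - int y"
      "x' \<in> T" "y' \<in> T" "t = int x' - int y'"
      by blast
    then show ?case
      by (intro bexI[of _ "x + y'"] bexI[of _ "y + x'"]) (auto simp: T_add)
  qed
  have "Gcd (int ` S) = 1"
    by (simp add: gcd)
  hence "1 \<in> group_closure (int ` S)"
    by (simp add: group_closure_eq)
  from diff[OF this] obtain x y where xy: "x \<in> T" "y \<in> T" "int x - int y = 1"
    by metis
  have xy': "x = y + 1"
    using xy(3) by simp
  have "n \<in> S" if n: "n \<ge> y * y + 1" for n
  proof (cases "y = 0")
    case True
    with xy(1) xy' have "n \<in> T"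
      using T_mult[of 1 n] by simp
    with n show ?thesis
      by (auto simp: T_def)
  next
    case False
    have "n mod y < y"
      using False by simp
    moreover have "y \<le> n div y"
      using n False by (metis Suc_eq_plus1 Suc_leD div_le_mono nonzero_mult_div_cancel_left)
    ultimately have le: "n mod y \<le> n div y"
      by linarith
    have "(n div y - n mod y) * y + n mod y * x = n div y * y + n mod y"
      using le by (simp add: xy' algebra_simps flip: add_mult_distrib)
    hence "n \<in> T"
      using T_add[OF T_mult[OF xy(2)] T_mult[OF xy(1)], of "n div y - n mod y" "n mod y"] by simp
    with n show ?thesis
      by (auto simp: T_def)
  qed
  thus ?thesis
    unfolding eventually_sequentially by blast
qed

text \<open>
  The loop lengths at a state form an additive semigroup with greatest common divisor 1, so from some time on
  there are loops of every length; irreducibility connects the states to them.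
\<close>

lemma eventually_leads_to:
  fixes K :: "'s::finite \<Rightarrow> ((int ^ 'd) \<times> 's) pmf"
  assumes irreducible: "\<And>i j. \<exists>n x. leads_to K n i x j"
    and aperiodic: "\<And>j. Gcd {n. n \<ge> 1 \<and> (\<exists>x. leads_to K n j x j)} = 1"
  shows "\<forall>\<^sub>F n in sequentially. \<forall>i j. \<exists>x. leads_to K n i x j"
proof -
  have "\<forall>\<^sub>F n in sequentially. \<exists>x. leads_to K n i x j" for i j
  proof -
    have "\<forall>\<^sub>F n in sequentially. n \<in> {n. n \<ge> 1 \<and> (\<exists>x. leads_to K n j x j)}"
      using aperiodic[of j] by (intro numerical_semigroup_cofinite) (auto dest: leads_to_add)
    then obtain N where N: "\<And>n. n \<ge> N \<Longrightarrow> \<exists>x. leads_to K n j x j"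
      by (auto simp: eventually_sequentially)
    from irreducible obtain m y where m: "leads_to K m i y j"
      by blast
    have "\<exists>x. leads_to K n i x j" if n: "n \<ge> m + N" for n
    proof -
      have "N \<le> n - m"
        using n by simp
      from N[OF this] obtain x where "leads_to K (n - m) j x j"
        by blast
      from leads_to_add[OF m this] n show ?thesis
        by auto
    qed
    thus ?thesis
      unfolding eventually_sequentially by blast
  qed
  thus ?thesis
    by (simp add: eventually_all_finite)
qed

definition state_average :: "('s \<Rightarrow> ((int ^ 'd) \<times> 's) pmf) \<Rightarrow> nat \<Rightarrow> ('s \<Rightarrow> real) \<Rightarrow> 's \<Rightarrow> real" where
  "state_average K n f j = (\<integral>s. f (snd s) \<partial>walk K n (0, j))"

lemma state_average_walk: "(\<integral>s'. f (snd s') \<partial>walk K n s) = state_average K n f (snd s)"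
  by (subst walk_from_origin) (simp add: state_average_def)

lemma bounded_finite_range:
  fixes f :: "'s::finite \<Rightarrow> real"
  obtains B where "\<And>k. \<bar>f k\<bar> \<le> B"
proof
  show "\<bar>f k\<bar> \<le> (\<Sum>k\<in>UNIV. \<bar>f k\<bar>)" for k
    by (rule member_le_sum) auto
qed

lemma state_average_add:
  fixes K :: "'s::finite \<Rightarrow> ((int ^ 'd) \<times> 's) pmf"
  shows "state_average K (m + n) f j = state_average K m (state_average K n f) j"
proof -
  obtain B where "\<And>k. \<bar>f k\<bar> \<le> B"
    using bounded_finite_range by blast
  hence "state_average K (m + n) f j
      = (\<integral>s. \<integral>s'. f (snd s') \<partial>walk K n s \<partial>walk K m (0, j))"
    unfolding state_average_def walk_add by (intro integral_bind_pmf_real)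
  thus ?thesis
    by (simp add: state_average_walk)
qed

text \<open>
  The average puts at least the weight \<open>\<delta>\<close> on the value \<open>f l\<close> and the remaining weight on values
  in \<open>[a, b]\<close>.
\<close>

lemma state_average_bounds:
  fixes K :: "'s::finite \<Rightarrow> ((int ^ 'd) \<times> 's) pmf"
  assumes f: "\<And>k. a \<le> f k" "\<And>k. f k \<le> b"
    and reach: "\<delta> \<le> measure (walk K n (0, j)) {s. snd s = l}"
  shows "a + \<delta> * (f l - a) \<le> state_average K n f j"
    and "state_average K n f j \<le> b - \<delta> * (b - f l)"
proof -
  let ?P = "walk K n (0, j)"
  obtain B where B: "\<And>k. \<bar>f k\<bar> \<le> B"
    using bounded_finite_range by blast
  have int: "integrable (measure_pmf ?P) (\<lambda>s. f (snd s))"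
    by (rule integrable_pmf_bounded[where B = B]) (simp add: B)
  have ind1: "integrable (measure_pmf ?P) (indicator {s. snd s = l} :: _ \<Rightarrow> real)"
    by (rule integrable_pmf_bounded[where B = 1]) (simp add: indicator_def)
  have ind: "integrable (measure_pmf ?P) (\<lambda>s. c * indicator {s. snd s = l} s)" for c :: real
    by (rule integrable_pmf_bounded[where B = "\<bar>c\<bar>"]) (simp add: indicator_def)
  let ?m = "measure ?P {s. snd s = l}"
  have "a + ?m * (f l - a) = (\<integral>s. a + (f l - a) * indicator {s. snd s = l} s \<partial>?P)"
    by (subst Bochner_Integration.integral_add) (auto intro: ind simp: ind1)
  also have "\<dots> \<le> state_average K n f j"
    unfolding state_average_def
    by (intro integral_mono Bochner_Integration.integrable_add ind int) (auto simp: indicator_def f)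
  finally have "a + ?m * (f l - a) \<le> state_average K n f j" .
  moreover have "\<delta> * (f l - a) \<le> ?m * (f l - a)"
    using reach f by (intro mult_right_mono) (auto simp: algebra_simps)
  ultimately show "a + \<delta> * (f l - a) \<le> state_average K n f j"
    by linarith
  have "state_average K n f j \<le> (\<integral>s. b - (b - f l) * indicator {s. snd s = l} s \<partial>?P)"
    unfolding state_average_def
    by (intro integral_mono Bochner_Integration.integrable_diff ind int) (auto simp: indicator_def f)
  also have "\<dots> = b - ?m * (b - f l)"
    by (subst Bochner_Integration.integral_diff) (auto intro: ind simp: ind1)
  finally have "state_average K n f j \<le> b - ?m * (b - f l)" .
  moreover have "\<delta> * (b - f l) \<le> ?m * (b - f l)"
    using reach f by (intro mult_right_mono) (auto simp: algebra_simps)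
  ultimately show "state_average K n f j \<le> b - \<delta> * (b - f l)"
    by linarith
qed

definition oscillation_le :: "('s \<Rightarrow> real) \<Rightarrow> real \<Rightarrow> bool" where
  "oscillation_le f w \<longleftrightarrow> (\<exists>a. \<forall>k. a \<le> f k \<and> f k \<le> a + w)"

text \<open>
  Doeblin's argument: for every starting state a fraction \<open>\<delta>\<close> of the average is the same number
  \<open>f l\<close>, so only the fraction \<open>1 - \<delta>\<close> contributes to the oscillation.
\<close>

lemma oscillation_le_state_average:
  fixes K :: "'s::finite \<Rightarrow> ((int ^ 'd) \<times> 's) pmf"
  assumes "oscillation_le f w"
    and reach: "\<And>j. \<delta> \<le> measure (walk K n (0, j)) {s. snd s = l}"
  shows "oscillation_le (state_average K n f) ((1 - \<delta>) * w)"
proof -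
  obtain a where a: "\<And>k. a \<le> f k" "\<And>k. f k \<le> a + w"
    using assms(1) by (auto simp: oscillation_le_def)
  show ?thesis
    unfolding oscillation_le_def
    using state_average_bounds[where f = f, OF a reach]
    by (intro exI[of _ "a + \<delta> * (f l - a)"]) (simp add: algebra_simps)
qed

text \<open>
  In \<open>R\<close> steps every internal state reaches a fixed state with probability at least \<open>\<delta>\<close>, so
  the oscillation of the averages decays geometrically along multiples of \<open>R\<close>. The bound
  \<open>w\<close> obtained in this way is a step function with geometric heights, and it is summable.
\<close>

lemma mixing_rate:
  fixes K :: "'s::finite \<Rightarrow> ((int ^ 'd) \<times> 's) pmf"
  assumes "\<forall>\<^sub>F n in sequentially. \<forall>i j. \<exists>x. leads_to K n i x j"
  obtains w :: "nat \<Rightarrow> real" and C where "\<And>r. 0 \<le> w r" "\<And>n. (\<Sum>r<n. w r) \<le> C"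
    "\<And>f r. oscillation_le f 1 \<Longrightarrow> oscillation_le (state_average K r f) (w r)"
proof -
  obtain N where "\<And>n. n \<ge> N \<Longrightarrow> \<forall>i j. \<exists>x. leads_to K n i x j"
    using assms by (auto simp: eventually_sequentially)
  then obtain R where R: "R \<ge> 1" "\<And>i j. \<exists>x. leads_to K R i x j"
    by (metis nat_le_linear)
  obtain l :: 's where True by blast
  define m where "m i = measure (walk K R (0, i)) {s. snd s = l}" for i
  have m_pos: "0 < m i" for i
  proof -
    obtain x where "leads_to K R i x l"
      using R by blast
    hence "0 < pmf (walk K R (0, i)) (x, l)"
      by (simp add: leads_to_def pmf_positive)
    also have "\<dots> \<le> m i"
      unfolding m_def measure_pmf_single[symmetric] by (rule measure_pmf.finite_measure_mono) auto
    finally show ?thesis .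
  qed
  define \<delta> where "\<delta> = Min (range m)"
  have \<delta>: "0 < \<delta>" "\<And>i. \<delta> \<le> m i"
    using m_pos by (auto simp: \<delta>_def)
  have "\<delta> \<le> 1"
    using \<delta>(2)[of l] by (simp add: m_def) (meson measure_pmf.prob_le_1 order_trans)
  define \<rho> where "\<rho> = 1 - \<delta>"
  have \<rho>: "0 \<le> \<rho>" "\<rho> < 1"
    using \<delta>(1) \<open>\<delta> \<le> 1\<close> by (auto simp: \<rho>_def)
  have zero: "oscillation_le (state_average K r f) w" if "oscillation_le f w" for r f w
    using oscillation_le_state_average[OF that, of 0 K r l] by simp
  have power: "oscillation_le (state_average K (q * R) f) (\<rho> ^ q)" if "oscillation_le f 1" for q f
  proof (induction q)
    case 0
    then show ?case
      using zero[OF that] by simp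
  next
    case (Suc q)
    have "oscillation_le (state_average K R (state_average K (q * R) f)) (\<rho> * \<rho> ^ q)"
      unfolding \<rho>_def by (rule oscillation_le_state_average[where l = l]) (use Suc \<delta> in \<open>auto simp: \<rho>_def m_def\<close>)
    thus ?case
      by (simp add: state_average_add[abs_def])
  qed
  show thesis
  proof (rule that[of "\<lambda>r. \<rho> ^ (r div R)" "real R / (1 - \<rho>)"])
    show "0 \<le> \<rho> ^ (r div R)" for r
      using \<rho> by simp
    show "oscillation_le (state_average K r f) (\<rho> ^ (r div R))" if "oscillation_le f 1" for f r
    proof -
      have "oscillation_le (state_average K (r mod R) (state_average K (r div R * R) f)) (\<rho> ^ (r div R))"
        by (rule zero[OF power[OF that]])
      also have "state_average K (r mod R) (state_average K (r div R * R) f) = state_average K r f"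
        by (rule ext) (simp flip: state_average_add)
      finally show ?thesis .
    qed
    show "(\<Sum>r<n. \<rho> ^ (r div R)) \<le> real R / (1 - \<rho>)" for n
    proof -
      have "(\<Sum>r<n. \<rho> ^ (r div R)) \<le> (\<Sum>r<n * R. \<rho> ^ (r div R))"
        using R \<rho> by (intro sum_mono2) auto
      also have "\<dots> = (\<Sum>q<n. \<Sum>r\<in>{q * R..<q * R + R}. \<rho> ^ (r div R))"
        by (rule sum.nat_group[symmetric])
      also have "\<dots> = (\<Sum>q<n. real R * \<rho> ^ q)"
      proof (rule sum.cong[OF refl])
        fix q
        have "r div R = q" if "r \<in> {q * R..<q * R + R}" for r
          using that by (intro div_nat_eqI) (auto simp: algebra_simps)
        thus "(\<Sum>r\<in>{q * R..<q * R + R}. \<rho> ^ (r div R)) = real R * \<rho> ^ q"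
          by simp
      qed
      also have "\<dots> = real R * ((1 - \<rho> ^ n) / (1 - \<rho>))"
        using \<rho> by (simp add: sum_gp_strict flip: sum_distrib_left)
      also have "\<dots> \<le> real R * (1 / (1 - \<rho>))"
        using \<rho> by (intro mult_left_mono divide_right_mono) auto
      finally show ?thesis
        by simp
    qed
  qed
qed

section \<open>Decay of the characteristic function\<close>

definition phase :: "('d::finite \<Rightarrow> real) \<Rightarrow> int ^ 'd \<Rightarrow> real" where
  "phase t x = (\<Sum>l\<in>UNIV. t l * real_of_int (x $ l))"

lemma phase_add: "phase t (x + y) = phase t x + phase t y"
  and phase_diff: "phase t (x - y) = phase t x - phase t y"
  and phase_0 [simp]: "phase t 0 = 0"
  by (simp_all add: phase_def distrib_left right_diff_distrib sum.distrib sum_subtractf)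

lemma phase_axis: "phase t (axis l 1) = t l"
proof -
  have "phase t (axis l 1) = (\<Sum>i\<in>UNIV. if i = l then t i else 0)"
    unfolding phase_def by (intro sum.cong) (auto simp: axis_def)
  thus ?thesis by simp
qed

text \<open>
  The \<open>n\<close>-step transition matrix twisted by the character \<open>x \<mapsto> exp(i \<langle>t, x\<rangle>)\<close> acts on the
  functions \<open>g\<close> of the internal state, and \<open>\<theta>\<close> bounds its operator norm for the supremum norm.
  Since this is an operator norm, it is submultiplicative in \<open>n\<close> (\<open>damped_add\<close>).
\<close>

definition damped ::
  "('s \<Rightarrow> ((int ^ 'd::finite) \<times> 's) pmf) \<Rightarrow> nat \<Rightarrow> ('d \<Rightarrow> real) \<Rightarrow> real \<Rightarrow> bool" where
  "damped K n t \<theta> \<longleftrightarrow> (\<forall>g j. (\<forall>k. norm (g k) \<le> 1) \<longrightarrow>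
     norm (\<integral>s. cis (phase t (fst s)) * g (snd s) \<partial>walk K n (0, j)) \<le> \<theta>)"

lemma dampedD:
  "damped K n t \<theta> \<Longrightarrow> (\<And>k. norm (g k) \<le> 1) \<Longrightarrow>
     norm (\<integral>s. cis (phase t (fst s)) * g (snd s) \<partial>walk K n (0, j)) \<le> \<theta>"
  unfolding damped_def by blast

lemma damped_nonneg: "damped K n t \<theta> \<Longrightarrow> 0 \<le> \<theta>"
  using dampedD[of K n t \<theta> "\<lambda>_. 0"] by simp

lemma damped_mono: "damped K n t \<theta> \<Longrightarrow> \<theta> \<le> \<theta>' \<Longrightarrow> damped K n t \<theta>'"
  unfolding damped_def by (meson order_trans)

lemma damped_trivial: "damped K n t 1"
  unfolding damped_def by (auto intro!: norm_integral_pmf_le simp: norm_mult)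

lemma damped_scaled:
  assumes "damped K n t \<theta>" "\<And>k. norm (g k) \<le> b"
  shows "norm (\<integral>s. cis (phase t (fst s)) * g (snd s) \<partial>walk K n (0, j)) \<le> \<theta> * b"
proof (cases "b = 0")
  case True
  hence "g k = 0" for k
    using assms(2)[of k] by simp
  thus ?thesis
    using True by simp
next
  case False
  hence b: "b > 0"
    using assms(2) norm_ge_zero by (metis less_eq_real_def order_trans)
  have "norm (\<integral>s. cis (phase t (fst s)) * (g (snd s) / of_real b) \<partial>walk K n (0, j)) \<le> \<theta>"
    using assms b by (intro dampedD[where g = "\<lambda>k. g k / of_real b"]) (auto simp: norm_divide)
  also have "(\<integral>s. cis (phase t (fst s)) * (g (snd s) / of_real b) \<partial>walk K n (0, j))
      = (\<integral>s. cis (phase t (fst s)) * g (snd s) \<partial>walk K n (0, j)) / of_real b"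
    by (subst integral_divide_zero[symmetric]) simp
  finally show ?thesis
    using b by (simp add: norm_divide field_simps)
qed

text \<open>
  Starting from \<open>u\<close> multiplies the transform by a phase that depends only on the position of
  \<open>u\<close>; this makes the twisted matrices compose.
\<close>

lemma character_integral_translate:
  "(\<integral>s. cis (phase t (fst s)) * g (snd s) \<partial>walk K n u)
     = cis (phase t (fst u)) * (\<integral>s. cis (phase t (fst s)) * g (snd s) \<partial>walk K n (0, snd u))"
  by (subst walk_from_origin) (simp add: phase_add cis_mult[symmetric] mult.assoc)

lemma damped_add:
  fixes K :: "'s::finite \<Rightarrow> ((int ^ 'd::finite) \<times> 's) pmf"
  assumes "damped K m t \<alpha>" "damped K n t \<beta>"
  shows "damped K (m + n) t (\<alpha> * \<beta>)"
  unfolding damped_def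
proof (intro allI impI)
  fix g :: "'s \<Rightarrow> complex" and j
  assume g: "\<forall>k. norm (g k) \<le> 1"
  define h where "h k = (\<integral>s. cis (phase t (fst s)) * g (snd s) \<partial>walk K n (0, k))" for k
  have h: "norm (h k) \<le> \<beta>" for k
    unfolding h_def using assms(2) g by (intro dampedD) auto
  have "(\<integral>s. cis (phase t (fst s)) * g (snd s) \<partial>walk K (m + n) (0, j))
      = (\<integral>s'. \<integral>s. cis (phase t (fst s)) * g (snd s) \<partial>walk K n s' \<partial>walk K m (0, j))"
    unfolding walk_add using g by (intro integral_bind_pmf_complex[where B = 1]) (auto simp: norm_mult)
  also have "\<dots> = (\<integral>s'. cis (phase t (fst s')) * h (snd s') \<partial>walk K m (0, j))"
    by (subst character_integral_translate) (simp add: h_def)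
  also have "norm \<dots> \<le> \<alpha> * \<beta>"
    by (rule damped_scaled[OF assms(1) h])
  finally show "norm (\<integral>s. cis (phase t (fst s)) * g (snd s) \<partial>walk K (m + n) (0, j)) \<le> \<alpha> * \<beta>" .
qed

lemma damped_power:
  fixes K :: "'s::finite \<Rightarrow> ((int ^ 'd::finite) \<times> 's) pmf"
  assumes "damped K N t \<theta>"
  shows "damped K n t (\<theta> ^ (n div N))"
proof -
  have "damped K (q * N) t (\<theta> ^ q)" for q
  proof (induction q)
    case (Suc q)
    then show ?case
      using damped_add[OF assms, of "q * N" "\<theta> ^ q"] by simp
  qed (simp add: damped_trivial)
  from damped_add[OF this[of "n div N"] damped_trivial[of K "n mod N" t]] show ?thesis
    by simp
qed

text \<open>
  All the mass except \<open>c\<close> at each of the atoms \<open>a\<close> and \<open>b\<close> is bounded trivially; only at the two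
  atoms is the cancellation between \<open>f a\<close> and \<open>f b\<close> kept.
\<close>

lemma norm_integral_two_atoms_le:
  fixes f :: "'a \<Rightarrow> complex"
  assumes f: "\<And>x. norm (f x) \<le> 1" and "a \<noteq> b"
    and c: "0 < c" "c \<le> pmf P a" "c \<le> pmf P b"
  shows "norm (\<integral>x. f x \<partial>P) \<le> 1 - 2 * c + c * norm (f a + f b)"
proof -
  \<comment> \<open>The fraction of the mass at \<open>x\<close> that is set aside: it amounts to \<open>c\<close> at each of the two atoms.\<close>
  define u where "u x = (if x = a \<or> x = b then c / pmf P x else 0)" for x
  have u: "0 \<le> u x" "u x \<le> 1" for x
    using c by (auto simp: u_def)
  have bound: "norm (w x * f x) \<le> 1" if "\<And>x. norm (w x) \<le> 1" for w :: "'a \<Rightarrow> complex" and x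
    unfolding norm_mult using that f by (intro mult_le_one) auto
  have int1: "integrable (measure_pmf P) (\<lambda>x. complex_of_real (u x) * f x)"
    and int2: "integrable (measure_pmf P) (\<lambda>x. complex_of_real (1 - u x) * f x)"
    using u by (auto intro!: integrable_pmf_bounded[where B = 1] bound simp del: of_real_diff)
  have int3: "integrable (measure_pmf P) u" "integrable (measure_pmf P) (\<lambda>x. 1 - u x)"
    using u by (auto intro!: integrable_pmf_bounded[where B = 1])
  have "(\<integral>x. f x \<partial>P) = (\<integral>x. of_real (u x) * f x + of_real (1 - u x) * f x \<partial>P)"
    by (simp add: algebra_simps)
  also have "\<dots> = (\<integral>x. of_real (u x) * f x \<partial>P) + (\<integral>x. of_real (1 - u x) * f x \<partial>P)"
    by (intro Bochner_Integration.integral_add int1 int2)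
  finally have split: "(\<integral>x. f x \<partial>P) = \<dots>" .
  have "(\<integral>x. of_real (u x) * f x \<partial>P) = (\<Sum>x\<in>{a, b}. pmf P x *\<^sub>R (of_real (u x) * f x))"
    by (intro integral_measure_pmf) (auto simp: u_def split: if_splits)
  also have "\<dots> = of_real c * (f a + f b)"
    using \<open>a \<noteq> b\<close> c by (simp add: u_def scaleR_conv_of_real algebra_simps)
  finally have "norm (\<integral>x. of_real (u x) * f x \<partial>P) = c * norm (f a + f b)"
    using c by (simp add: norm_mult)
  moreover have "norm (\<integral>x. of_real (1 - u x) * f x \<partial>P) \<le> 1 - 2 * c"
  proof -
    have "norm (\<integral>x. of_real (1 - u x) * f x \<partial>P) \<le> (\<integral>x. norm (of_real (1 - u x) * f x) \<partial>P)"
      by (rule integral_norm_bound)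
    also have "\<dots> \<le> (\<integral>x. 1 - u x \<partial>P)"
    proof (intro integral_mono integrable_norm int2 int3)
      fix x
      show "norm (of_real (1 - u x) * f x) \<le> 1 - u x"
        using u[of x] f[of x] by (simp add: norm_mult mult_left_le del: of_real_diff)
    qed
    also have "\<dots> = 1 - (\<integral>x. u x \<partial>P)"
      using int3 by (simp add: Bochner_Integration.integral_diff)
    also have "(\<integral>x. u x \<partial>P) = (\<Sum>x\<in>{a, b}. u x * pmf P x)"
      by (intro integral_measure_pmf_real) (auto simp: u_def split: if_splits)
    also have "\<dots> = 2 * c"
      using \<open>a \<noteq> b\<close> c by (simp add: u_def)
    finally show ?thesis .
  qed
  ultimately show ?thesis
    unfolding split using norm_triangle_ineq by (smt (verit))
qed

lemma norm_cis_add_le: "norm (cis x + cis y) \<le> 2 - (sin ((x - y) / 2))\<^sup>2"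
proof -
  let ?h = "(x - y) / 2"
  have "cis x = cis ((x + y) / 2) * cis ?h" "cis y = cis ((x + y) / 2) * cis (- ?h)"
    unfolding cis_mult by (simp_all add: field_simps)
  hence "cis x + cis y = cis ((x + y) / 2) * (cis ?h + cis (- ?h))"
    by (simp add: distrib_left)
  also have "cis ?h + cis (- ?h) = of_real (2 * cos ?h)"
    by (rule complex_eqI) auto
  finally have "norm (cis x + cis y) = 2 * \<bar>cos ?h\<bar>"
    by (simp add: norm_mult del: of_real_mult)
  moreover have "2 * \<bar>cos ?h\<bar> \<le> 1 + (cos ?h)\<^sup>2"
    using zero_le_power2[of "1 - \<bar>cos ?h\<bar>"] by (simp add: power2_eq_square algebra_simps)
  ultimately show ?thesis
    by (simp add: sin_squared_eq)
qed

text \<open>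
  Blocks of \<open>N\<close> steps contract at the frequencies \<open>t\<close> whose character is not 1 at \<open>z\<close>,
  with a constant \<open>c\<close> that is uniform in \<open>t\<close>. Requiring this for all large \<open>N\<close> allows a common block length
  for several \<open>z\<close>.
\<close>

definition resolves :: "('s \<Rightarrow> ((int ^ 'd::finite) \<times> 's) pmf) \<Rightarrow> int ^ 'd \<Rightarrow> bool" where
  "resolves K z \<longleftrightarrow> (\<forall>\<^sub>F N in sequentially. \<exists>c>0. \<forall>t. damped K N t (1 - c * (sin (phase t z / 2))\<^sup>2))"

text \<open>
  From any internal state one can first go to \<open>j\<close> in \<open>N - n\<close> steps and then run either of the two
  loops. This produces two atoms of the \<open>N\<close>-step law with the same internal state and with positions
  that differ by \<open>y - y'\<close>.
\<close>

lemma resolves_loop_difference: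
  fixes K :: "'s::finite \<Rightarrow> ((int ^ 'd::finite) \<times> 's) pmf"
  assumes mix: "\<forall>\<^sub>F n in sequentially. \<forall>i j. \<exists>x. leads_to K n i x j"
    and loops: "leads_to K n j y j" "leads_to K n j y' j"
  shows "resolves K (y - y')"
proof -
  obtain N0 where N0: "\<And>n i j. n \<ge> N0 \<Longrightarrow> \<exists>x. leads_to K n i x j"
    using mix unfolding eventually_sequentially by blast
  have "\<exists>c>0. \<forall>t. damped K N t (1 - c * (sin (phase t (y - y') / 2))\<^sup>2)" if N: "N \<ge> n + N0" for N
  proof (cases "y = y'")
    case True
    thus ?thesis
      by (intro exI[of _ 1]) (auto simp: damped_trivial)
  next
    case False
    have "\<exists>x. leads_to K (N - n) i x j" for i
      using N by (intro N0) auto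
    then obtain x where x: "\<And>i. leads_to K (N - n) i (x i) j"
      by metis
    have atoms: "leads_to K N i (x i + y) j" "leads_to K N i (x i + y') j" for i
      using leads_to_add[OF x loops(1), of i] leads_to_add[OF x loops(2), of i] N by simp_all
    define m where "m i = min (pmf (walk K N (0, i)) (x i + y, j)) (pmf (walk K N (0, i)) (x i + y', j))" for i
    define c where "c = Min (range m)"
    have "0 < m i" for i
      using atoms[of i] by (simp add: m_def leads_to_def pmf_positive)
    hence c: "0 < c" "\<And>i. c \<le> m i"
      by (auto simp: c_def)
    have "damped K N t (1 - c * (sin (phase t (y - y') / 2))\<^sup>2)" for t
      unfolding damped_def
    proof (intro allI impI)
      fix g :: "'s \<Rightarrow> complex" and i
      assume g: "\<forall>k. norm (g k) \<le> 1"
      define f where "f s = cis (phase t (fst s)) * g (snd s)" for s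
      have "norm (\<integral>s. f s \<partial>walk K N (0, i))
          \<le> 1 - 2 * c + c * norm (f (x i + y, j) + f (x i + y', j))"
        using c(1) c(2)[of i] False g
        by (intro norm_integral_two_atoms_le) (auto simp: f_def norm_mult m_def)
      also have "norm (f (x i + y, j) + f (x i + y', j))
          = norm (cis (phase t (x i + y)) + cis (phase t (x i + y'))) * norm (g j)"
        by (simp add: f_def flip: norm_mult distrib_right)
      also have "\<dots> \<le> norm (cis (phase t (x i + y)) + cis (phase t (x i + y')))"
        using g by (intro mult_left_le) auto
      also have "\<dots> \<le> 2 - (sin (phase t (y - y') / 2))\<^sup>2"
        using norm_cis_add_le[of "phase t (x i + y)" "phase t (x i + y')"]
        by (simp add: phase_add phase_diff)
      finally have "norm (\<integral>s. f s \<partial>walk K N (0, i))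
          \<le> 1 - 2 * c + c * (2 - (sin (phase t (y - y') / 2))\<^sup>2)"
        using c(1) by (auto simp: mult_left_mono)
      thus "norm (\<integral>s. cis (phase t (fst s)) * g (snd s) \<partial>walk K N (0, i))
          \<le> 1 - c * (sin (phase t (y - y') / 2))\<^sup>2"
        by (simp add: f_def algebra_simps)
    qed
    with c show ?thesis
      by blast
  qed
  thus ?thesis
    unfolding resolves_def eventually_sequentially by blast
qed

lemma sin_diff_squared_le: "(sin (x - y))\<^sup>2 \<le> 2 * ((sin x)\<^sup>2 + (sin y)\<^sup>2)" for x y :: real
proof -
  have "\<bar>sin (x - y)\<bar> \<le> \<bar>sin x\<bar> * \<bar>cos y\<bar> + \<bar>cos x\<bar> * \<bar>sin y\<bar>"
    unfolding sin_diff by (metis abs_mult abs_triangle_ineq4)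
  also have "\<dots> \<le> \<bar>sin x\<bar> + \<bar>sin y\<bar>"
    by (intro add_mono mult_left_le mult_left_le_one_le) auto
  finally have "\<bar>sin (x - y)\<bar>\<^sup>2 \<le> (\<bar>sin x\<bar> + \<bar>sin y\<bar>)\<^sup>2"
    by (intro power_mono) auto
  also have "\<dots> \<le> 2 * (\<bar>sin x\<bar>\<^sup>2 + \<bar>sin y\<bar>\<^sup>2)"
    using zero_le_power2[of "\<bar>sin x\<bar> - \<bar>sin y\<bar>"] by (simp add: power2_eq_square algebra_simps)
  finally show ?thesis
    by simp
qed

text \<open>
  By \<open>sin_diff_squared_le\<close>, at every frequency the stronger of the contractions provided by
  \<open>y\<close> and by \<open>z\<close> is, up to a constant, as strong as the one required for \<open>y - z\<close>.
\<close>

lemma resolves_diff: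
  assumes "resolves K y" "resolves K z"
  shows "resolves K (y - z)"
  using assms unfolding resolves_def
proof eventually_elim
  case (elim N)
  then obtain a b where a: "a > 0" "\<And>t. damped K N t (1 - a * (sin (phase t y / 2))\<^sup>2)"
    and b: "b > 0" "\<And>t. damped K N t (1 - b * (sin (phase t z / 2))\<^sup>2)"
    by blast
  define c where "c = min a b / 4"
  have "damped K N t (1 - c * (sin (phase t (y - z) / 2))\<^sup>2)" for t
  proof -
    let ?y = "(sin (phase t y / 2))\<^sup>2" and ?z = "(sin (phase t z / 2))\<^sup>2"
    have "c * (sin (phase t (y - z) / 2))\<^sup>2 \<le> c * (2 * (?y + ?z))"
      using sin_diff_squared_le[of "phase t y / 2" "phase t z / 2"] a(1) b(1)
      by (intro mult_left_mono) (auto simp: phase_diff diff_divide_distrib c_def)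
    also have "\<dots> = min a b * (?y + ?z) / 2"
      by (simp add: c_def)
    also have "\<dots> \<le> min a b * max ?y ?z"
    proof -
      have "min a b * (?y + ?z) \<le> min a b * (2 * max ?y ?z)"
        using a(1) b(1) by (intro mult_left_mono) auto
      thus ?thesis by simp
    qed
    also have "\<dots> \<le> max (a * ?y) (b * ?z)"
    proof -
      have "min a b * ?y \<le> a * ?y" "min a b * ?z \<le> b * ?z"
        by (intro mult_right_mono; simp)+
      thus ?thesis
        unfolding max_def by (smt (verit))
    qed
    finally have "1 - a * ?y \<le> 1 - c * (sin (phase t (y - z) / 2))\<^sup>2
        \<or> 1 - b * ?z \<le> 1 - c * (sin (phase t (y - z) / 2))\<^sup>2"
      by linarith
    thus ?thesis
      using damped_mono a(2) b(2) by blast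
  qed
  moreover have "c > 0"
    using a b by (simp add: c_def)
  ultimately show ?case
    by blast
qed

lemma resolves_group_closure:
  assumes "\<And>z. z \<in> S \<Longrightarrow> resolves K z" "z \<in> group_closure S"
  shows "resolves K z"
  using assms(2)
proof (induction rule: group_closure.induct)
  case (base s)
  have "resolves K 0"
    unfolding resolves_def by (intro always_eventually allI exI[of _ 1]) (simp add: damped_trivial)
  with base assms(1) show ?case
    by auto
qed (rule resolves_diff)

text \<open>
  There are finitely many unit vectors, so they share a block length \<open>N\<close> and a constant; averaging the
  \<open>CARD('d)\<close> bounds gives the sum over the coordinates.
\<close>

lemma uniformly_damped:
  fixes K :: "'s::finite \<Rightarrow> ((int ^ 'd::finite) \<times> 's) pmf"
  assumes "\<And>z. resolves K z"
  obtains N c where "N \<ge> 1" "c > 0" "\<And>t. damped K N t (1 - c * (\<Sum>l\<in>UNIV. (sin (t l / 2))\<^sup>2))"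
proof -
  have "\<forall>\<^sub>F N in sequentially. \<forall>l. \<exists>c>0. \<forall>t. damped K N t (1 - c * (sin (t l / 2))\<^sup>2)"
    using assms[of "axis _ 1"] by (intro eventually_all_finite) (simp add: resolves_def phase_axis)
  then obtain N where N: "N \<ge> 1" "\<forall>l. \<exists>c>0. \<forall>t. damped K N t (1 - c * (sin (t l / 2))\<^sup>2)"
    unfolding eventually_sequentially by (metis nat_le_linear)
  then obtain a where a: "\<And>l. a l > 0" "\<And>l t. damped K N t (1 - a l * (sin (t l / 2))\<^sup>2)"
    by metis
  \<comment> \<open>Each \<open>a l\<close> may be replaced by the smallest one; dividing by the dimension pays for the averaging.\<close>
  define b where "b = Min (range a)"
  have b: "b > 0" "\<And>l. b \<le> a l"
    using a(1) by (auto simp: b_def)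
  define c where "c = b / real CARD('d)"
  show thesis
  proof (rule that[OF N(1)])
    show "c > 0"
      using b by (simp add: c_def)
    show "damped K N t (1 - c * (\<Sum>l\<in>UNIV. (sin (t l / 2))\<^sup>2))" for t
      unfolding damped_def
    proof (intro allI impI)
      fix g :: "'s \<Rightarrow> complex" and j
      assume g: "\<forall>k. norm (g k) \<le> 1"
      let ?I = "norm (\<integral>s. cis (phase t (fst s)) * g (snd s) \<partial>walk K N (0, j))"
      have "?I \<le> 1 - b * (sin (t l / 2))\<^sup>2" for l
      proof -
        have "?I \<le> 1 - a l * (sin (t l / 2))\<^sup>2"
          using g by (intro dampedD[OF a(2)]) auto
        moreover have "b * (sin (t l / 2))\<^sup>2 \<le> a l * (sin (t l / 2))\<^sup>2"
          using b by (intro mult_right_mono) auto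
        ultimately show ?thesis by linarith
      qed
      hence "(\<Sum>l::'d\<in>UNIV. ?I) \<le> (\<Sum>l\<in>UNIV. 1 - b * (sin (t l / 2))\<^sup>2)"
        by (intro sum_mono) auto
      hence "real CARD('d) * ?I \<le> real CARD('d) - b * (\<Sum>l\<in>UNIV. (sin (t l / 2))\<^sup>2)"
        by (simp add: sum_subtractf sum_distrib_left)
      thus "?I \<le> 1 - c * (\<Sum>l\<in>UNIV. (sin (t l / 2))\<^sup>2)"
        by (simp add: c_def field_simps)
    qed
  qed
qed

section \<open>The point masses of the walk\<close>

lemma sum_roots_of_unity:
  fixes K :: nat and y :: int
  assumes "K \<ge> 1"
  shows "(\<Sum>a<K. cis (2 * pi * real a / real K * real_of_int y)) = (if int K dvd y then of_nat K else 0)"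
proof -
  define z where "z = cis (2 * pi * real_of_int y / real K)"
  have terms: "cis (2 * pi * real a / real K * real_of_int y) = z ^ a" for a
    unfolding z_def Complex.DeMoivre by (simp add: field_simps)
  have zK: "z ^ K = 1"
    using assms cis_multiple_2pi[of "real_of_int y"] unfolding z_def Complex.DeMoivre
    by (simp add: field_simps)
  have z1: "z = 1 \<longleftrightarrow> int K dvd y"
  proof
    assume "z = 1"
    hence "cos (2 * pi * real_of_int y / real K) = 1"
      by (simp add: z_def complex_eq_iff)
    then obtain m :: int where "2 * pi * real_of_int y / real K = of_int m * 2 * pi"
      using cos_one_2pi_int by auto
    hence "real_of_int y = of_int (int K * m)"
      using assms by (simp add: field_simps)
    thus "int K dvd y"
      by (metis dvd_triv_left of_int_eq_iff)
  next
    assume "int K dvd y"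
    then obtain m where "y = int K * m" ..
    hence "2 * pi * real_of_int y / real K = 2 * pi * real_of_int m"
      using assms by simp
    thus "z = 1"
      using cis_multiple_2pi[of "real_of_int m"] by (simp add: z_def)
  qed
  show ?thesis
    unfolding terms using z1 zK by (auto simp: geometric_sum)
qed

text \<open>
  The mass of \<open>x\<close> is at most the mass of the class of \<open>x\<close> modulo \<open>K\<close>, and the indicator of
  this class is an average of characters over the \<open>K ^ CARD('d)\<close> frequencies in
  \<open>(2 \<pi> / K) \<int>\<^sup>d\<close> modulo \<open>2 \<pi>\<close>. A bound that is a product over the coordinates can then be summed coordinatewise.
\<close>

lemma point_mass_le_average_over_frequencies:
  fixes P :: "((int ^ 'd::finite) \<times> 's) pmf" and K :: nat
  assumes "K \<ge> 1"
    and bound: "\<And>t. norm (\<integral>s. cis (phase t (fst s)) \<partial>P) \<le> (\<Prod>l\<in>UNIV. b (t l))"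
  shows "measure P {s. fst s = x} \<le> ((\<Sum>a<K. b (2 * pi * real a / real K)) / real K) ^ CARD('d)"
proof -
  let ?F = "PiE UNIV (\<lambda>_::'d. {..<K})"
  define freq where "freq a l = 2 * pi * real (a l) / real K" for a :: "'d \<Rightarrow> nat" and l
  have sum_eq: "(\<Sum>a\<in>?F. cis (phase (freq a) (y - x)))
      = of_real (\<Prod>l\<in>UNIV. if int K dvd y $ l - x $ l then real K else 0)" for y
  proof -
    have "(\<Sum>a\<in>?F. cis (phase (freq a) (y - x)))
        = (\<Sum>a\<in>?F. \<Prod>l\<in>UNIV. cis (freq a l * real_of_int (y $ l - x $ l)))"
      by (simp add: phase_def cis_conv_exp exp_sum sum_distrib_left)
    also have "\<dots> = (\<Prod>l\<in>UNIV. \<Sum>k<K. cis (2 * pi * real k / real K * real_of_int (y $ l - x $ l)))"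
      unfolding freq_def by (rule prod_sum_PiE[symmetric]) auto
    also have "\<dots> = (\<Prod>l\<in>UNIV. of_real (if int K dvd y $ l - x $ l then real K else 0))"
      by (subst sum_roots_of_unity[OF assms(1)]) (intro prod.cong; simp)
    finally show ?thesis
      by simp
  qed
  have int: "integrable (measure_pmf P) (\<lambda>s. cis (phase t (fst s - x)))" for t
    by (rule integrable_pmf_bounded[where B = 1]) simp
  have intr: "integrable (measure_pmf P) (\<lambda>s. \<Prod>l\<in>UNIV. if int K dvd fst s $ l - x $ l then real K else 0)"
  proof (rule integrable_pmf_bounded[where B = "real K ^ CARD('d)"])
    fix s :: "(int ^ 'd) \<times> 's"
    have "(\<Prod>l\<in>UNIV. if int K dvd fst s $ l - x $ l then real K else 0) \<le> (\<Prod>l::'d\<in>UNIV. real K)"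
      by (rule prod_mono) auto
    thus "norm (\<Prod>l\<in>UNIV. if int K dvd fst s $ l - x $ l then real K else 0) \<le> real K ^ CARD('d)"
      by (simp add: prod_nonneg)
  qed
  have "real K ^ CARD('d) * measure P {s. fst s = x}
      = (\<integral>s. real K ^ CARD('d) * indicator {s. fst s = x} s \<partial>P)"
    by simp
  also have "\<dots> \<le> (\<integral>s. (\<Prod>l\<in>UNIV. if int K dvd fst s $ l - x $ l then real K else 0) \<partial>P)"
  proof (intro integral_mono intr)
    show "integrable (measure_pmf P) (\<lambda>s. real K ^ CARD('d) * indicator {s. fst s = x} s)"
      by (rule integrable_pmf_bounded[where B = "real K ^ CARD('d)"]) (auto simp: indicator_def)
  qed (auto simp: indicator_def prod_nonneg)
  also have "\<dots> = norm (of_real \<dots> :: complex)"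
    by (simp add: prod_nonneg integral_nonneg)
  also have "of_real (\<integral>s. (\<Prod>l\<in>UNIV. if int K dvd fst s $ l - x $ l then real K else 0) \<partial>P)
      = (\<integral>s. (\<Sum>a\<in>?F. cis (phase (freq a) (fst s - x))) \<partial>P)"
    unfolding sum_eq by (rule integral_complex_of_real[symmetric])
  also have "\<dots> = (\<Sum>a\<in>?F. \<integral>s. cis (phase (freq a) (fst s - x)) \<partial>P)"
    by (rule Bochner_Integration.integral_sum) (rule int)
  also have "norm \<dots> \<le> (\<Sum>a\<in>?F. \<Prod>l\<in>UNIV. b (freq a l))"
  proof (rule sum_norm_le)
    fix a :: "'d \<Rightarrow> nat"
    have "(\<integral>s. cis (phase (freq a) (fst s - x)) \<partial>P)
        = (\<integral>s. cis (- phase (freq a) x) * cis (phase (freq a) (fst s)) \<partial>P)"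
      by (simp add: phase_diff cis_mult)
    also have "\<dots> = cis (- phase (freq a) x) * (\<integral>s. cis (phase (freq a) (fst s)) \<partial>P)"
      by simp
    finally show "norm (\<integral>s. cis (phase (freq a) (fst s - x)) \<partial>P) \<le> (\<Prod>l\<in>UNIV. b (freq a l))"
      using bound[of "freq a"] by (simp add: norm_mult)
  qed
  also have "\<dots> = (\<Prod>l::'d\<in>UNIV. \<Sum>a<K. b (2 * pi * real a / real K))"
    unfolding freq_def by (rule prod_sum_PiE[symmetric]) auto
  also have "\<dots> = (\<Sum>a<K. b (2 * pi * real a / real K)) ^ CARD('d)"
    by simp
  finally show ?thesis
    using assms(1) by (simp add: power_divide field_simps)
qed

text \<open>
  A weak form of Jordan's inequality: up to \<open>\<pi> / 3\<close> the derivative \<open>cos\<close> is at least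
  \<open>1 / 2\<close>, and afterwards \<open>sin\<close> is at least \<open>\<surd>3 / 2\<close>, which exceeds \<open>\<pi> / 4\<close>.
\<close>

lemma sin_ge_linear:
  assumes "0 \<le> x" "x \<le> pi / 2"
  shows "x / 2 \<le> sin x"
proof -
  have "(\<lambda>x. sin x - x / 2) 0 \<le> sin x - x / 2" if "x \<le> pi / 3"
  proof (rule DERIV_nonneg_imp_nondecreasing[OF assms(1)])
    fix y assume "0 \<le> y" "y \<le> x"
    hence "cos (pi / 3) \<le> cos y"
      using that pi_gt_zero by (intro cos_monotone_0_pi_le) auto
    thus "\<exists>z. ((\<lambda>x. sin x - x / 2) has_real_derivative z) (at y) \<and> 0 \<le> z"
      by (intro exI[of _ "cos y - 1 / 2"]) (auto intro!: derivative_eq_intros simp: cos_60)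
  qed
  moreover have "x / 2 \<le> sin x" if "x \<ge> pi / 3"
  proof -
    have "sin (pi / 3) \<le> sin x"
      using assms that pi_gt_zero by (intro sin_monotone_2pi_le) auto
    moreover have "17 / 10 \<le> sqrt 3"
      by (rule real_le_rsqrt) (simp add: power2_eq_square)
    moreover have "x \<le> 17 / 10"
      using assms pi_less_4 pi_approx by simp
    ultimately show ?thesis
      by (simp add: sin_60)
  qed
  ultimately show ?thesis
    by force
qed

text \<open>
  The distance \<open>min a (K - a)\<close> of \<open>a\<close> to the multiples of \<open>K\<close> makes \<open>sin\<close> at least
  \<open>min a (K - a) / K\<close>, so for \<open>q \<ge> K\<^sup>2\<close> the summands decay at least geometrically in this distance.
\<close>

lemma gaussian_sum_le:
  fixes K :: nat
  assumes "K \<ge> 1" "c > 0" "real K ^ 2 \<le> q"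
  shows "(\<Sum>a<K. exp (- c * q * (sin (pi * real a / real K))\<^sup>2)) \<le> 2 / (1 - exp (- c))"
proof -
  have sin_le: "real (min a (K - a)) \<le> q * (sin (pi * real a / real K))\<^sup>2" if "a < K" for a
  proof -
    define m where "m = min a (K - a)"
    have half: "2 * m \<le> K"
      by (simp add: m_def)
    have "sin (pi * real a / real K) = sin (pi * real m / real K)"
    proof (cases "a \<le> K - a")
      case False
      hence "pi * real a / real K = pi - pi * real m / real K"
        using that by (simp add: m_def field_simps of_nat_diff)
      thus ?thesis
        by simp
    qed (simp add: m_def)
    moreover have "pi * real m / real K \<le> pi / 2"
      using half assms(1) pi_gt_zero by (simp add: field_simps)
    hence "pi * real m / real K / 2 \<le> sin (pi * real m / real K)"
      by (intro sin_ge_linear) auto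
    moreover have "real m / real K \<le> pi * real m / real K / 2"
    proof -
      define u where "u = real m / real K"
      have "u * 2 \<le> u * pi"
        using pi_ge_two by (intro mult_left_mono) (auto simp: u_def)
      hence "u \<le> u * pi / 2"
        by simp
      thus ?thesis
        by (simp add: u_def mult_ac)
    qed
    ultimately have "real m / real K \<le> sin (pi * real a / real K)"
      by linarith
    hence "(real m / real K)\<^sup>2 \<le> (sin (pi * real a / real K))\<^sup>2"
      by (intro power_mono) auto
    moreover have "0 \<le> q"
      using assms(3) by (rule order_trans[OF zero_le_power2])
    ultimately have "real K ^ 2 * (real m / real K)\<^sup>2 \<le> q * (sin (pi * real a / real K))\<^sup>2"
      using assms(3) by (intro mult_mono) auto
    moreover have "real m \<le> real K ^ 2 * (real m / real K)\<^sup>2"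
      using assms(1) by (simp add: power_divide power2_eq_square) (simp flip: of_nat_mult)
    ultimately show ?thesis
      by (simp add: m_def)
  qed
  define r where "r = exp (- c)"
  have r: "0 < r" "r < 1"
    using assms(2) by (simp_all add: r_def)
  have geometric: "(\<Sum>a<n. r ^ a) \<le> 1 / (1 - r)" for n
    using r by (simp add: sum_gp_strict divide_right_mono)
  have "(\<Sum>a<K. exp (- c * q * (sin (pi * real a / real K))\<^sup>2)) \<le> (\<Sum>a<K. r ^ a + r ^ (K - a))"
  proof (rule sum_mono)
    fix a assume "a \<in> {..<K}"
    hence "c * real (min a (K - a)) \<le> c * (q * (sin (pi * real a / real K))\<^sup>2)"
      using sin_le[of a] assms(2) by (intro mult_left_mono) auto
    hence "exp (- c * q * (sin (pi * real a / real K))\<^sup>2) \<le> exp (real (min a (K - a)) * (- c))"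
      by (simp add: mult_ac)
    also have "\<dots> = r ^ min a (K - a)"
      unfolding r_def by (rule exp_of_nat_mult)
    also have "\<dots> \<le> r ^ a + r ^ (K - a)"
      using r by (auto simp: min_def)
    finally show "exp (- c * q * (sin (pi * real a / real K))\<^sup>2) \<le> r ^ a + r ^ (K - a)" .
  qed
  also have "\<dots> = (\<Sum>a<K. r ^ a) + (\<Sum>a<K. r ^ (K - a))"
    by (rule sum.distrib)
  also have "(\<Sum>a<K. r ^ (K - a)) = (\<Sum>a<K. r ^ Suc a)"
    by (rule sum.reindex_bij_witness[of _ "\<lambda>a. K - Suc a" "\<lambda>a. K - Suc a"]) (auto simp: Suc_diff_Suc simp del: power_Suc)
  also have "\<dots> \<le> (\<Sum>a<K. r ^ a)"
    using r by (intro sum_mono) (auto simp: mult_left_le_one_le)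
  finally show ?thesis
    using geometric[of K] by (simp add: r_def)
qed

text \<open>
  Of \<open>n\<close> steps, \<open>n div N\<close> blocks contract the characteristic function. Reduction modulo
  \<open>k = \<lfloor>\<surd>(n div N)\<rfloor>\<close> is coarse enough for the sum over the frequencies to stay bounded in each coordinate,
  which leaves the factor \<open>1 / k\<close> per coordinate.
\<close>

lemma local_limit_upper_bound:
  fixes K :: "'s::finite \<Rightarrow> ((int ^ 'd::finite) \<times> 's) pmf"
  assumes "\<And>z. resolves K z"
  obtains C where "\<And>n x s. n \<ge> 1 \<Longrightarrow>
    measure (walk K n s) {s'. fst s' = x} \<le> C * real n powr - (real CARD('d) / 2)"
proof -
  obtain N c where N: "N \<ge> 1" and c: "c > 0"
    and damp: "\<And>t. damped K N t (1 - c * (\<Sum>l\<in>UNIV. (sin (t l / 2))\<^sup>2))"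
    using uniformly_damped[OF assms] by blast
  define D where "D = 2 / (1 - exp (- c))"
  have D: "D \<ge> 2"
    using c by (simp add: D_def field_simps)
  have char: "norm (\<integral>s'. cis (phase t (fst s')) \<partial>walk K n s)
      \<le> (\<Prod>l\<in>UNIV. exp (- c * real (n div N) * (sin (t l / 2))\<^sup>2))" for n s t
  proof -
    let ?S = "\<Sum>l\<in>UNIV. (sin (t l / 2))\<^sup>2"
    have "norm (\<integral>s'. cis (phase t (fst s')) \<partial>walk K n s) \<le> (1 - c * ?S) ^ (n div N)"
      using dampedD[OF damped_power[OF damp[of t], of n], where g = "\<lambda>_. 1" and j = "snd s"]
        character_integral_translate[where g = "\<lambda>_. 1" and u = s]
      by (simp add: norm_mult)
    also have "\<dots> \<le> exp (- (c * ?S)) ^ (n div N)"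
      using damped_nonneg[OF damp[of t]] exp_ge_add_one_self[of "- (c * ?S)"]
      by (intro power_mono) auto
    also have "\<dots> = exp (real (n div N) * (- (c * ?S)))"
      by (rule exp_of_nat_mult[symmetric])
    also have "\<dots> = exp (\<Sum>l\<in>UNIV. - c * real (n div N) * (sin (t l / 2))\<^sup>2)"
      by (simp add: mult_ac sum_distrib_left sum_negf)
    finally show ?thesis
      by (simp add: exp_sum)
  qed
  define C where "C = (2 * D * sqrt (real N)) ^ CARD('d)"
  have "measure (walk K n s) {s'. fst s' = x} \<le> C * real n powr - (real CARD('d) / 2)"
    if n: "n \<ge> 1" for n x s
  proof -
    have "real n powr - (real CARD('d) / 2) = sqrt (real n) powr - real CARD('d)"
      using n by (simp add: powr_powr flip: powr_half_sqrt)
    also have "\<dots> = 1 / sqrt (real n) ^ CARD('d)"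
      using n by (simp add: powr_minus_divide powr_realpow)
    finally have powr_eq:
      "(2 * D * sqrt (real N) / sqrt (real n)) ^ CARD('d) = C * real n powr - (real CARD('d) / 2)"
      by (simp add: C_def power_divide)
    show ?thesis
    proof (cases "n < N")
      case True
      hence "1 \<le> sqrt (real N) / sqrt (real n)"
        using n by simp
      hence "1 * 1 \<le> (2 * D) * (sqrt (real N) / sqrt (real n))"
        using D by (intro mult_mono) auto
      hence "1 \<le> (2 * D * sqrt (real N) / sqrt (real n)) ^ CARD('d)"
        by (intro one_le_power) simp
      thus ?thesis
        unfolding powr_eq by (meson measure_pmf.prob_le_1 order_trans)
    next
      case False
      define k where "k = floor_sqrt (n div N)"
      have "n div N \<ge> 1"
        using False N by (simp add: Suc_leI div_greater_zero_iff)
      hence k: "k \<ge> 1"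
        by (simp add: k_def Suc_leI)
      have k_le: "real k ^ 2 \<le> real (n div N)"
        unfolding k_def by (metis floor_sqrt_power2_le of_nat_le_iff of_nat_power)
      have "(Suc k)\<^sup>2 \<le> (2 * k)\<^sup>2"
        using k by (intro power_mono) auto
      hence "n div N < (2 * k)\<^sup>2"
        using Suc_floor_sqrt_power2_gt[of "n div N"] unfolding k_def by linarith
      hence "Suc (n div N) * N \<le> (2 * k)\<^sup>2 * N"
        by (intro mult_right_mono) auto
      moreover have "n < Suc (n div N) * N"
        using N dividend_less_div_times[of N n] by (simp add: add.commute)
      ultimately have "n \<le> (2 * k)\<^sup>2 * N"
        by linarith
      hence "real n \<le> (2 * real k)\<^sup>2 * real N"
        by (metis of_nat_le_iff of_nat_mult of_nat_numeral of_nat_power)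
      hence "sqrt (real n) \<le> 2 * real k * sqrt (real N)"
        using real_sqrt_le_mono[of "real n" "(2 * real k)\<^sup>2 * real N"] by (simp add: real_sqrt_mult)
      hence k_ge: "D / real k \<le> 2 * D * sqrt (real N) / sqrt (real n)"
        using k n D by (simp add: field_simps mult_left_mono)
      have "measure (walk K n s) {s'. fst s' = x}
          \<le> ((\<Sum>a<k. exp (- c * real (n div N) * (sin (2 * pi * real a / real k / 2))\<^sup>2)) / real k) ^ CARD('d)"
        by (rule point_mass_le_average_over_frequencies[OF k char])
      also have "\<dots> \<le> (D / real k) ^ CARD('d)"
        using gaussian_sum_le[OF k c k_le]
        by (intro power_mono divide_right_mono) (auto simp: D_def intro!: divide_nonneg_nonneg sum_nonneg)
      also have "\<dots> \<le> (2 * D * sqrt (real N) / sqrt (real n)) ^ CARD('d)"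
        using k_ge D by (intro power_mono) auto
      finally show ?thesis
        by (simp add: powr_eq)
    qed
  qed
  thus thesis
    by (rule that)
qed

section \<open>The Markov property of the path\<close>

text \<open>
  On a countable type the values of measure zero form a null set, so every law is a probability mass function.
\<close>

lemma measure_pmf_Abs_pmf_distr:
  fixes X :: "'w \<Rightarrow> 'a::countable"
  assumes "prob_space M" and X: "X \<in> M \<rightarrow>\<^sub>M count_space UNIV"
  shows "measure_pmf (Abs_pmf (distr M (count_space UNIV) X)) = distr M (count_space UNIV) X"
proof (rule Abs_pmf_inverse, safe)
  let ?N = "distr M (count_space UNIV) X"
  show N: "prob_space ?N"
    by (rule prob_space.prob_space_distr[OF assms])
  interpret N: prob_space ?N by (rule N)
  have "{x. measure ?N {x} = 0} = (\<Union>x\<in>{x. measure ?N {x} = 0}. {x})"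
    by auto
  also have "\<dots> \<in> null_sets ?N"
    by (rule null_sets_UN') (auto simp: null_sets_def N.emeasure_eq_measure)
  finally show "AE x in ?N. measure ?N {x} \<noteq> 0"
    by (intro AE_I'[of "{x. measure ?N {x} = 0}"]) auto
qed auto

text \<open>
  The process \<open>\<xi>\<close> is a Markov chain with the transition law \<open>jump K\<close>, in the elementary
  sense of conditional probabilities given a path of positive probability.
\<close>

locale internal_state_walk = prob_space M for M :: "'w measure" +
  fixes K :: "'s::finite \<Rightarrow> ((int ^ 'd::finite) \<times> 's) pmf"
    and \<xi> :: "nat \<Rightarrow> 'w \<Rightarrow> (int ^ 'd) \<times> 's"
  assumes measurable_position: "\<xi> n \<in> M \<rightarrow>\<^sub>M count_space UNIV"
    and markov: "0 < \<P>(\<omega> in M. \<forall>i\<le>n. \<xi> i \<omega> = h i) \<Longrightarrow>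
      \<P>(\<omega> in M. \<xi> (Suc n) \<omega> = s \<bar> \<forall>i\<le>n. \<xi> i \<omega> = h i) = pmf (jump K (h n)) s"
begin

text \<open>
  The path up to time \<open>a\<close> as a list: lists over a countable type are countable, so every function of
  the path is measurable.
\<close>

definition history :: "nat \<Rightarrow> 'w \<Rightarrow> ((int ^ 'd) \<times> 's) list" where
  "history a \<omega> = map (\<lambda>i. \<xi> i \<omega>) [0..<Suc a]"

lemma history_Suc: "history (Suc a) \<omega> = history a \<omega> @ [\<xi> (Suc a) \<omega>]"
  by (simp add: history_def)

lemma take_history: "a \<le> b \<Longrightarrow> take (Suc a) (history b \<omega>) = history a \<omega>"
  unfolding history_def by (subst take_map) (simp add: take_upt del: upt_Suc)

lemma last_history [simp]: "last (history a \<omega>) = \<xi> a \<omega>"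
  by (simp add: history_def)

lemma nth_history: "i \<le> a \<Longrightarrow> history a \<omega> ! i = \<xi> i \<omega>"
  by (simp add: history_def del: upt_Suc)

lemma history_eq_iff: "history a \<omega> = h \<longleftrightarrow> length h = Suc a \<and> (\<forall>i\<le>a. \<xi> i \<omega> = h ! i)"
  unfolding history_def list_eq_iff_nth_eq by (auto simp del: upt_Suc simp: less_Suc_eq_le)

lemma measurable_history: "history a \<in> M \<rightarrow>\<^sub>M count_space UNIV"
proof (induction a)
  case 0
  have "(\<lambda>\<omega>. [\<xi> 0 \<omega>]) \<in> M \<rightarrow>\<^sub>M count_space UNIV"
    by (rule measurable_compose[OF measurable_position]) simp
  thus ?case
    by (simp add: history_def[abs_def])
next
  case (Suc a)
  have "(\<lambda>\<omega>. (history a \<omega>, \<xi> (Suc a) \<omega>)) \<in> M \<rightarrow>\<^sub>M count_space UNIV \<Otimes>\<^sub>M count_space UNIV"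
    by (intro measurable_Pair Suc measurable_position)
  hence "(\<lambda>\<omega>. (history a \<omega>, \<xi> (Suc a) \<omega>)) \<in> M \<rightarrow>\<^sub>M count_space UNIV"
    by (simp add: pair_measure_countable)
  hence "(\<lambda>\<omega>. (\<lambda>(h, s). h @ [s]) (history a \<omega>, \<xi> (Suc a) \<omega>)) \<in> M \<rightarrow>\<^sub>M count_space UNIV"
    by (rule measurable_compose) simp
  thus ?case
    by (simp add: history_Suc[abs_def])
qed

lemma measurable_of_history: "(\<lambda>\<omega>. G (history a \<omega>)) \<in> borel_measurable M"
  by (rule measurable_compose[OF measurable_history]) simp

lemma history_event: "{\<omega> \<in> space M. P (history a \<omega>)} \<in> sets M"
  using measurable_sets[OF measurable_history, of "{h. P h}" a]
  by (simp add: vimage_def Int_def conj_commute)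

lemma integrable_of_history:
  fixes G :: "((int ^ 'd) \<times> 's) list \<Rightarrow> real"
  assumes "\<And>h. \<bar>G h\<bar> \<le> B"
  shows "integrable M (\<lambda>\<omega>. G (history a \<omega>))"
  by (rule integrable_const_bound[where B = B]) (auto simp: assms measurable_of_history)

definition history_law :: "nat \<Rightarrow> ((int ^ 'd) \<times> 's) list pmf" where
  "history_law a = Abs_pmf (distr M (count_space UNIV) (history a))"

lemma measure_pmf_history_law:
  "measure_pmf (history_law a) = distr M (count_space UNIV) (history a)"
  unfolding history_law_def
  by (rule measure_pmf_Abs_pmf_distr[OF prob_space_axioms measurable_history])

lemma expectation_history:
  fixes G :: "((int ^ 'd) \<times> 's) list \<Rightarrow> real"
  shows "expectation (\<lambda>\<omega>. G (history a \<omega>)) = (\<integral>h. G h \<partial>history_law a)"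
  unfolding measure_pmf_history_law by (rule integral_distr[symmetric, OF measurable_history]) simp

lemma pmf_history_law: "pmf (history_law a) h = \<P>(\<omega> in M. history a \<omega> = h)"
  unfolding measure_pmf_single[symmetric] measure_pmf_history_law
  by (subst measure_distr[OF measurable_history]) (auto intro: arg_cong[where f = prob])

lemma pmf_history_law_snoc:
  "pmf (history_law (Suc a)) (h @ [s]) = pmf (history_law a) h * pmf (jump K (last h)) s"
proof (cases "length h = Suc a")
  case False
  hence "\<P>(\<omega> in M. history (Suc a) \<omega> = h @ [s]) = 0" "\<P>(\<omega> in M. history a \<omega> = h) = 0"
    by (simp_all add: history_eq_iff)
  thus ?thesis
    by (simp add: pmf_history_law)
next
  case True
  hence last: "last h = h ! a"
    by (metis diff_Suc_1 last_conv_nth length_0_conv nat.distinct(1))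
  have eq: "history a \<omega> = h \<longleftrightarrow> (\<forall>i\<le>a. \<xi> i \<omega> = h ! i)" for \<omega>
    using True by (simp add: history_eq_iff)
  have "\<P>(\<omega> in M. history (Suc a) \<omega> = h @ [s]) = \<P>(\<omega> in M. \<xi> (Suc a) \<omega> = s \<and> history a \<omega> = h)"
    by (simp add: history_Suc conj_commute)
  also have "\<dots> = \<P>(\<omega> in M. history a \<omega> = h) * pmf (jump K (last h)) s"
  proof (cases "\<P>(\<omega> in M. history a \<omega> = h) = 0")
    case True
    have "\<P>(\<omega> in M. \<xi> (Suc a) \<omega> = s \<and> history a \<omega> = h) \<le> \<P>(\<omega> in M. history a \<omega> = h)"
      by (intro finite_measure_mono history_event) auto
    with True show ?thesis
      by (simp add: order_antisym)
  next
    case False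
    hence "0 < \<P>(\<omega> in M. \<forall>i\<le>a. \<xi> i \<omega> = h ! i)"
      by (simp add: eq zero_less_measure_iff)
    from markov[OF this, of s] False show ?thesis
      by (simp add: cond_prob_def last field_simps flip: eq)
  qed
  finally show ?thesis
    by (simp add: pmf_history_law)
qed

text \<open>
  The elementary Markov property says exactly that the path up to time \<open>a + 1\<close> arises from the
  path up to time \<open>a\<close> by appending one jump from its last point.
\<close>

lemma history_law_Suc:
  "history_law (Suc a)
     = bind_pmf (history_law a) (\<lambda>h. map_pmf (\<lambda>s. h @ [s]) (jump K (last h)))"
proof (rule pmf_eqI)
  fix x
  show "pmf (history_law (Suc a)) x
      = pmf (bind_pmf (history_law a) (\<lambda>h. map_pmf (\<lambda>s. h @ [s]) (jump K (last h)))) x"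
  proof (cases x rule: rev_cases)
    case Nil
    have "\<P>(\<omega> in M. history (Suc a) \<omega> = []) = 0"
      by (simp add: history_Suc)
    moreover have "pmf (map_pmf (\<lambda>s. h @ [s]) (jump K (last h))) [] = 0" for h
      by (auto simp: pmf_eq_0_set_pmf)
    ultimately show ?thesis
      by (simp add: Nil pmf_bind pmf_history_law)
  next
    case (snoc h s)
    have step: "pmf (map_pmf (\<lambda>s. h' @ [s]) (jump K (last h'))) x
        = (if h' = h then pmf (jump K (last h)) s else 0)" for h'
    proof (cases "h' = h")
      case True
      have "pmf (map_pmf (\<lambda>s. h @ [s]) (jump K (last h))) (h @ [s]) = pmf (jump K (last h)) s"
        by (rule pmf_map_inj') (simp add: inj_def)
      with True snoc show ?thesis
        by simp
    qed (auto simp: snoc pmf_eq_0_set_pmf)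
    have "(\<integral>h'. (if h' = h then pmf (jump K (last h)) s else 0) \<partial>history_law a)
        = (\<Sum>h'\<in>{h}. (if h' = h then pmf (jump K (last h)) s else 0) * pmf (history_law a) h')"
      by (rule integral_measure_pmf_real) (auto split: if_splits)
    thus ?thesis
      by (simp add: pmf_bind step) (simp add: snoc pmf_history_law_snoc)
  qed
qed

lemma expectation_one_step:
  assumes "\<And>h s. \<bar>F h s\<bar> \<le> (B::real)"
  shows "expectation (\<lambda>\<omega>. F (history a \<omega>) (\<xi> (Suc a) \<omega>))
     = expectation (\<lambda>\<omega>. \<integral>s. F (history a \<omega>) s \<partial>jump K (\<xi> a \<omega>))"
proof -
  have "expectation (\<lambda>\<omega>. F (history a \<omega>) (\<xi> (Suc a) \<omega>))
      = expectation (\<lambda>\<omega>. F (butlast (history (Suc a) \<omega>)) (last (history (Suc a) \<omega>)))"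
    by (simp add: history_Suc)
  also have "\<dots> = (\<integral>h. F (butlast h) (last h) \<partial>history_law (Suc a))"
    by (rule expectation_history)
  also have "\<dots> = (\<integral>h. \<integral>s. F h s \<partial>jump K (last h) \<partial>history_law a)"
    unfolding history_law_Suc using assms by (subst integral_bind_pmf_real[where B = B]) auto
  also have "\<dots> = expectation (\<lambda>\<omega>. \<integral>s. F (history a \<omega>) s \<partial>jump K (last (history a \<omega>)))"
    by (rule expectation_history[symmetric])
  finally show ?thesis
    by simp
qed

text \<open>
  Conditioning on the path up to time \<open>a\<close>: the later position may be replaced by its conditional law,
  even if the test function \<open>F\<close> depends on the path.
\<close>

lemma expectation_n_steps:
  assumes "\<And>h s. \<bar>F h s\<bar> \<le> (B::real)"
  shows "expectation (\<lambda>\<omega>. F (history a \<omega>) (\<xi> (a + n) \<omega>))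
     = expectation (\<lambda>\<omega>. \<integral>s. F (history a \<omega>) s \<partial>walk K n (\<xi> a \<omega>))"
  using assms
proof (induction n arbitrary: F)
  case 0
  then show ?case
    by simp
next
  case (Suc n)
  have take: "take (Suc a) (history (a + n) \<omega>) = history a \<omega>" for \<omega>
    by (simp add: take_history)
  have "expectation (\<lambda>\<omega>. F (history a \<omega>) (\<xi> (a + Suc n) \<omega>))
      = expectation (\<lambda>\<omega>. F (take (Suc a) (history (a + n) \<omega>)) (\<xi> (Suc (a + n)) \<omega>))"
    by (simp add: take)
  also have "\<dots> = expectation (\<lambda>\<omega>. \<integral>s. F (take (Suc a) (history (a + n) \<omega>)) s \<partial>jump K (\<xi> (a + n) \<omega>))"
    by (rule expectation_one_step) (rule Suc.prems)
  also have "\<dots> = expectation (\<lambda>\<omega>. \<integral>s'. \<integral>s. F (history a \<omega>) s \<partial>jump K s' \<partial>walk K n (\<xi> a \<omega>))"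
    unfolding take using norm_integral_pmf_le[OF Suc.prems[folded real_norm_def]]
    by (intro Suc.IH) simp
  also have "\<dots> = expectation (\<lambda>\<omega>. \<integral>s. F (history a \<omega>) s \<partial>walk K (Suc n) (\<xi> a \<omega>))"
    by (simp add: integral_bind_pmf_real[OF Suc.prems])
  finally show ?case .
qed

end

text \<open>
  The probability that the walk from \<open>s\<close> avoids the site \<open>x\<close> at the times 1, ..., \<open>m\<close>; the
  starting point itself may be \<open>x\<close>. The recursion is on the first step.
\<close>

primrec avoid_prob ::
  "('s \<Rightarrow> ((int ^ 'd) \<times> 's) pmf) \<Rightarrow> nat \<Rightarrow> int ^ 'd \<Rightarrow> (int ^ 'd) \<times> 's \<Rightarrow> real" where
  "avoid_prob K 0 x s = 1"
| "avoid_prob K (Suc m) x s = (\<integral>s'. of_bool (fst s' \<noteq> x) * avoid_prob K m x s' \<partial>jump K s)"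

lemma avoid_prob_bounds: "0 \<le> avoid_prob K m x s" "avoid_prob K m x s \<le> 1"
proof -
  have "0 \<le> avoid_prob K m x s \<and> avoid_prob K m x s \<le> 1"
  proof (induction m arbitrary: s)
    case (Suc m)
    have "\<bar>of_bool (fst s' \<noteq> x) * avoid_prob K m x s'\<bar> \<le> 1" for s'
      using Suc[of s'] by simp
    from norm_integral_pmf_le[OF this[folded real_norm_def], of "jump K s"] Suc show ?case
      by (auto intro!: integral_nonneg)
  qed simp
  thus "0 \<le> avoid_prob K m x s" "avoid_prob K m x s \<le> 1"
    by auto
qed

lemma avoid_prob_translate: "avoid_prob K m (z + x) (translate z s) = avoid_prob K m x s"
  by (induction m arbitrary: s) (simp_all add: jump_translate)

text \<open>
  The probability of not returning to the current site depends on the internal state only. This is why the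
  correlations between distant times are governed by the internal chain alone.
\<close>

lemma avoid_prob_start: "avoid_prob K m (fst s) s = avoid_prob K m 0 (0, snd s)"
  using avoid_prob_translate[of K m "fst s" 0 "(0, snd s)"] by (simp add: translate_origin)

context internal_state_walk
begin

text \<open>
  The Markov property for an event about \<open>m\<close> future steps, by induction on the first of them: the
  condition on the position at time \<open>a + 1\<close> is absorbed into the test function \<open>\<phi>\<close> of the past.
\<close>

lemma expectation_avoid:
  assumes "\<And>h. \<bar>\<phi> h\<bar> \<le> (B::real)"
  shows "expectation (\<lambda>\<omega>. \<phi> (history a \<omega>) * of_bool (\<forall>k\<in>{a<..a + m}. fst (\<xi> k \<omega>) \<noteq> v (history a \<omega>)))
     = expectation (\<lambda>\<omega>. \<phi> (history a \<omega>) * avoid_prob K m (v (history a \<omega>)) (\<xi> a \<omega>))"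
  using assms
proof (induction m arbitrary: a \<phi> v)
  case 0
  then show ?case
    by simp
next
  case (Suc m)
  have take: "take (Suc a) (history (Suc a) \<omega>) = history a \<omega>" for \<omega>
    by (simp add: take_history)
  have interval: "{a<..a + Suc m} = insert (Suc a) {Suc a<..Suc a + m}"
    by auto
  define \<psi> where "\<psi> h = \<phi> (take (Suc a) h) * of_bool (fst (last h) \<noteq> v (take (Suc a) h))" for h
  have \<psi>: "\<bar>\<psi> h\<bar> \<le> B" for h
    using Suc.prems[of "take (Suc a) h"] order_trans[OF abs_ge_zero Suc.prems[of "take (Suc a) h"]]
    by (simp add: \<psi>_def)
  have "expectation (\<lambda>\<omega>. \<phi> (history a \<omega>) * of_bool (\<forall>k\<in>{a<..a + Suc m}. fst (\<xi> k \<omega>) \<noteq> v (history a \<omega>)))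
      = expectation (\<lambda>\<omega>. \<psi> (history (Suc a) \<omega>)
          * of_bool (\<forall>k\<in>{Suc a<..Suc a + m}. fst (\<xi> k \<omega>) \<noteq> v (take (Suc a) (history (Suc a) \<omega>))))"
    unfolding interval by (intro Bochner_Integration.integral_cong refl) (auto simp: \<psi>_def take)
  also have "\<dots> = expectation (\<lambda>\<omega>. \<psi> (history (Suc a) \<omega>) * avoid_prob K m (v (take (Suc a) (history (Suc a) \<omega>))) (\<xi> (Suc a) \<omega>))"
    by (rule Suc.IH) (rule \<psi>)
  also have "\<dots> = expectation (\<lambda>\<omega>. \<phi> (history a \<omega>) *
      (of_bool (fst (\<xi> (Suc a) \<omega>) \<noteq> v (history a \<omega>)) * avoid_prob K m (v (history a \<omega>)) (\<xi> (Suc a) \<omega>)))"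
    by (simp only: \<psi>_def take last_history mult.assoc)
  also have "\<dots> = expectation (\<lambda>\<omega>. \<integral>s. \<phi> (history a \<omega>) *
      (of_bool (fst s \<noteq> v (history a \<omega>)) * avoid_prob K m (v (history a \<omega>)) s) \<partial>jump K (\<xi> a \<omega>))"
  proof (rule expectation_one_step[where B = B])
    fix h s
    have "\<bar>\<phi> h\<bar> * \<bar>of_bool (fst s \<noteq> v h) * avoid_prob K m (v h) s\<bar> \<le> B * 1"
      using Suc.prems[of h] avoid_prob_bounds[of K m "v h" s]
      by (intro mult_mono) (auto intro: order_trans[OF abs_ge_zero])
    thus "\<bar>\<phi> h * (of_bool (fst s \<noteq> v h) * avoid_prob K m (v h) s)\<bar> \<le> B"
      by (simp add: abs_mult)
  qed
  finally show ?case
    by simp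
qed

lemma expectation_return_le:
  assumes "\<And>x s. measure (walk K n s) {s'. fst s' = x} \<le> b"
  shows "expectation (\<lambda>\<omega>. of_bool (fst (\<xi> (a + n) \<omega>) = fst (\<xi> a \<omega>))) \<le> b"
proof -
  have meas: "(\<integral>s'. (of_bool (fst s' = x) :: real) \<partial>walk K n s) = measure (walk K n s) {s'. fst s' = x}" for x s
  proof -
    have "(\<integral>s'. (of_bool (fst s' = x) :: real) \<partial>walk K n s) = (\<integral>s'. indicator {s'. fst s' = x} s' \<partial>walk K n s)"
      by (intro Bochner_Integration.integral_cong) (auto simp: indicator_def)
    thus ?thesis
      by simp
  qed
  have "expectation (\<lambda>\<omega>. of_bool (fst (\<xi> (a + n) \<omega>) = fst (\<xi> a \<omega>)) :: real)
      = expectation (\<lambda>\<omega>. of_bool (fst (\<xi> (a + n) \<omega>) = fst (last (history a \<omega>))) :: real)"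
    by simp
  also have "\<dots> = expectation (\<lambda>\<omega>. \<integral>s. of_bool (fst s = fst (last (history a \<omega>))) \<partial>walk K n (\<xi> a \<omega>))"
    by (rule expectation_n_steps[where F = "\<lambda>h s. of_bool (fst s = fst (last h))" and B = 1]) simp
  also have "\<dots> = expectation (\<lambda>\<omega>. measure (walk K n (last (history a \<omega>)))
      {s'. fst s' = fst (last (history a \<omega>))})"
    by (simp add: meas)
  also have "\<dots> \<le> expectation (\<lambda>\<omega>. b)"
  proof (rule integral_mono)
    show "integrable M (\<lambda>\<omega>. measure (walk K n (last (history a \<omega>))) {s'. fst s' = fst (last (history a \<omega>))})"
      by (rule integrable_of_history[where B = 1]) simp
  qed (simp_all add: assms)
  finally show ?thesis
    by (simp add: prob_space)
qed

text \<open>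
  With \<open>m = n - i\<close> this is the indicator that time \<open>i\<close> is the last visit of its site up to time \<open>n\<close>.
\<close>

definition no_early_return :: "nat \<Rightarrow> nat \<Rightarrow> 'w \<Rightarrow> real" where
  "no_early_return m i \<omega> = of_bool (\<forall>k\<in>{i<..i + m}. fst (\<xi> k \<omega>) \<noteq> fst (\<xi> i \<omega>))"

lemma no_early_return_bounds: "0 \<le> no_early_return m i \<omega>" "no_early_return m i \<omega> \<le> 1"
  by (simp_all add: no_early_return_def)

lemma no_early_return_history:
  assumes "i + m \<le> a"
  shows "no_early_return m i \<omega>
    = of_bool (\<forall>k\<in>{i<..i + m}. fst (history a \<omega> ! k) \<noteq> fst (history a \<omega> ! i))"
  using assms by (simp add: no_early_return_def nth_history)

text \<open>
  Given the path up to time \<open>a\<close>, the expectation of the later indicator is \<open>g\<close> of the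
  internal state at time \<open>a\<close>, where \<open>g\<close> is an \<open>r\<close>-step average of the probabilities of not
  returning. Since \<open>\<phi>\<close> is centred, subtracting a constant from \<open>g\<close> changes nothing, and what
  remains is at most the oscillation \<open>w\<close> of \<open>g\<close>.
\<close>

lemma covariance_no_early_return_le:
  assumes mix: "\<And>f. oscillation_le f 1 \<Longrightarrow> oscillation_le (state_average K r f) w"
    and phi: "\<And>h. \<bar>\<phi> h\<bar> \<le> (1::real)" "expectation (\<lambda>\<omega>. \<phi> (history a \<omega>)) = 0"
  shows "expectation (\<lambda>\<omega>. \<phi> (history a \<omega>) * no_early_return m (a + r) \<omega>) \<le> w"
proof -
  define f where "f k = avoid_prob K m 0 (0, k)" for k
  have f: "0 \<le> f k" "f k \<le> 1" for k
    by (simp_all add: f_def avoid_prob_bounds)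
  hence "oscillation_le f 1"
    unfolding oscillation_le_def by (intro exI[of _ 0]) simp
  from mix[OF this] obtain lo where lo:
    "\<And>k. lo \<le> state_average K r f k" "\<And>k. state_average K r f k \<le> lo + w"
    by (auto simp: oscillation_le_def)
  define g where "g = state_average K r f"
  have take: "take (Suc a) (history (a + r) \<omega>) = history a \<omega>" for \<omega>
    by (simp add: take_history)
  have "expectation (\<lambda>\<omega>. \<phi> (history a \<omega>) * no_early_return m (a + r) \<omega>)
      = expectation (\<lambda>\<omega>. \<phi> (take (Suc a) (history (a + r) \<omega>))
          * of_bool (\<forall>k\<in>{a + r<..a + r + m}. fst (\<xi> k \<omega>) \<noteq> fst (last (history (a + r) \<omega>))))"
    by (simp add: take no_early_return_def)
  also have "\<dots> = expectation (\<lambda>\<omega>. \<phi> (take (Suc a) (history (a + r) \<omega>))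
      * avoid_prob K m (fst (last (history (a + r) \<omega>))) (\<xi> (a + r) \<omega>))"
    by (rule expectation_avoid) (rule phi(1))
  also have "\<dots> = expectation (\<lambda>\<omega>. \<phi> (history a \<omega>) * f (snd (\<xi> (a + r) \<omega>)))"
    by (simp add: take avoid_prob_start f_def)
  also have "\<dots> = expectation (\<lambda>\<omega>. \<integral>s. \<phi> (history a \<omega>) * f (snd s) \<partial>walk K r (\<xi> a \<omega>))"
  proof (rule expectation_n_steps[where B = 1])
    show "\<bar>\<phi> h * f (snd s)\<bar> \<le> 1" for h s
      unfolding abs_mult using phi(1) f by (intro mult_le_one) (auto simp: abs_of_nonneg)
  qed
  also have "\<dots> = expectation (\<lambda>\<omega>. \<phi> (history a \<omega>) * g (snd (last (history a \<omega>))))"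
    by (simp add: state_average_walk g_def)
  also have "\<dots> = expectation (\<lambda>\<omega>. \<phi> (history a \<omega>) * (g (snd (last (history a \<omega>))) - lo))"
  proof -
    have "\<bar>g k\<bar> \<le> \<bar>lo\<bar> + \<bar>w\<bar>" for k
      using lo[of k] by (simp add: g_def)
    hence "\<bar>\<phi> h * g k\<bar> \<le> 1 * (\<bar>lo\<bar> + \<bar>w\<bar>)" for h k
      unfolding abs_mult using phi(1) by (intro mult_mono) auto
    hence "integrable M (\<lambda>\<omega>. \<phi> (history a \<omega>) * g (snd (last (history a \<omega>))))"
      by (intro integrable_of_history)
    moreover have "integrable M (\<lambda>\<omega>. \<phi> (history a \<omega>))"
      by (rule integrable_of_history[OF phi(1)])
    ultimately show ?thesis
      by (simp add: right_diff_distrib phi(2))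
  qed
  also have "\<dots> \<le> expectation (\<lambda>\<omega>. w)"
  proof (intro integral_mono)
    have le: "\<phi> h * (g k - lo) \<le> w" "\<bar>\<phi> h * (g k - lo)\<bar> \<le> w" for h k
    proof -
      have "\<bar>\<phi> h\<bar> * \<bar>g k - lo\<bar> \<le> 1 * w"
        using phi(1) lo[of k] by (intro mult_mono) (auto simp: g_def)
      thus "\<bar>\<phi> h * (g k - lo)\<bar> \<le> w"
        by (simp add: abs_mult)
      thus "\<phi> h * (g k - lo) \<le> w"
        by simp
    qed
    show "integrable M (\<lambda>\<omega>. \<phi> (history a \<omega>) * (g (snd (last (history a \<omega>))) - lo))"
      by (rule integrable_of_history) (rule le(2))
    show "\<phi> (history a \<omega>) * (g (snd (last (history a \<omega>))) - lo) \<le> w" for \<omega>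
      by (rule le(1))
  qed auto
  finally show ?thesis
    by (simp add: prob_space)
qed

end

section \<open>The variance of the number of visited sites\<close>

lemma card_image_eq_card_last_occurrences:
  fixes f :: "nat \<Rightarrow> 'a"
  shows "card (f ` {..n}) = card {i \<in> {..n}. \<forall>k\<in>{i<..n}. f k \<noteq> f i}"
proof -
  let ?L = "{i \<in> {..n}. \<forall>k\<in>{i<..n}. f k \<noteq> f i}"
  have "f i \<in> f ` ?L" if "i \<le> n" for i
  proof -
    define j where "j = Max {k \<in> {..n}. f k = f i}"
    have j: "j \<in> {k \<in> {..n}. f k = f i}"
      unfolding j_def using that by (intro Max_in) auto
    have "f k \<noteq> f j" if "k \<in> {j<..n}" for k
    proof
      assume "f k = f j"
      with j that have "k \<le> j"
        unfolding j_def by (intro Max_ge) auto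
      with that show False
        by simp
    qed
    with j have "j \<in> ?L"
      by auto
    moreover have "f i = f j"
      using j by simp
    ultimately show ?thesis
      by blast
  qed
  hence "f ` {..n} = f ` ?L"
    by auto
  moreover have "inj_on f ?L"
  proof (rule inj_onI)
    fix i j assume "i \<in> ?L" "j \<in> ?L" "f i = f j"
    thus "i = j"
      by (cases i j rule: linorder_cases) auto
  qed
  ultimately show ?thesis
    by (simp add: card_image)
qed

text \<open>
  Both the indices below \<open>i\<close> and those from \<open>i\<close> on have distinct distances to \<open>i\<close>.
\<close>

lemma sum_differences_le:
  fixes c :: "nat \<Rightarrow> real"
  assumes "\<And>r. 0 \<le> c r" "i \<le> n"
  shows "(\<Sum>j\<le>n. c (if i \<le> j then j - i else i - j)) \<le> 2 * (\<Sum>r\<le>n. c r)"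
proof -
  have "{..n} = {..<i} \<union> {i..n}"
    using assms(2) by auto
  hence "(\<Sum>j\<le>n. c (if i \<le> j then j - i else i - j))
      = (\<Sum>j\<in>{..<i} \<union> {i..n}. c (if i \<le> j then j - i else i - j))"
    by simp
  also have "\<dots> = (\<Sum>j\<in>{..<i}. c (i - j)) + (\<Sum>j\<in>{i..n}. c (j - i))"
    by (subst sum.union_disjoint) (auto intro!: arg_cong2[where f = "(+)"] sum.cong)
  also have "(\<Sum>j\<in>{..<i}. c (i - j)) = (\<Sum>r\<in>{0<..i}. c r)"
    by (rule sum.reindex_bij_witness[of _ "\<lambda>r. i - r" "\<lambda>j. i - j"]) auto
  also have "\<dots> \<le> (\<Sum>r\<le>n. c r)"
    using assms by (intro sum_mono2) auto
  also have "(\<Sum>j\<in>{i..n}. c (j - i)) = (\<Sum>r\<in>{..n - i}. c r)"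
    using assms(2) by (intro sum.reindex_bij_witness[of _ "\<lambda>r. r + i" "\<lambda>j. j - i"]) auto
  also have "\<dots> \<le> (\<Sum>r\<le>n. c r)"
    using assms by (intro sum_mono2) auto
  finally show ?thesis
    by simp
qed

context internal_state_walk
begin

lemma visited_sites_eq_sum: "real (visited_sites \<xi> n \<omega>) = (\<Sum>i\<le>n. no_early_return (n - i) i \<omega>)"
proof -
  have "visited_sites \<xi> n \<omega>
      = card {i \<in> {..n}. \<forall>k\<in>{i<..n}. fst (\<xi> k \<omega>) \<noteq> fst (\<xi> i \<omega>)}"
    unfolding visited_sites_def by (rule card_image_eq_card_last_occurrences)
  also have "real \<dots> = (\<Sum>i\<in>{i \<in> {..n}. \<forall>k\<in>{i<..n}. fst (\<xi> k \<omega>) \<noteq> fst (\<xi> i \<omega>)}. 1)"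
    by simp
  also have "\<dots> = (\<Sum>i\<le>n. no_early_return (n - i) i \<omega>)"
    by (rule sum.mono_neutral_cong_left) (auto simp: no_early_return_def)
  finally show ?thesis .
qed

lemma measurable_no_early_return [measurable]: "no_early_return m i \<in> borel_measurable M"
proof -
  define G :: "_ \<Rightarrow> real"
    where "G h = of_bool (\<forall>k\<in>{i<..i + m}. fst (h ! k) \<noteq> fst (h ! i))"
    for h :: "((int ^ 'd) \<times> 's) list"
  have "no_early_return m i = (\<lambda>\<omega>. G (history (i + m) \<omega>))"
    unfolding G_def by (rule ext) (rule no_early_return_history[OF order_refl])
  thus ?thesis
    using measurable_of_history[of G "i + m"] by simp
qed

lemma integrable_bounded:
  fixes f :: "'w \<Rightarrow> real"
  assumes "f \<in> borel_measurable M" "\<And>\<omega>. \<bar>f \<omega>\<bar> \<le> B"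
  shows "integrable M f"
  by (rule integrable_const_bound[where B = B]) (auto simp: assms)

lemma expectation_bounds:
  fixes f :: "'w \<Rightarrow> real"
  assumes "integrable M f" "\<And>\<omega>. a \<le> f \<omega>" "\<And>\<omega>. f \<omega> \<le> b"
  shows "a \<le> expectation f" "expectation f \<le> b"
proof -
  have "expectation (\<lambda>_. a) \<le> expectation f"
    by (intro integral_mono assms) simp
  thus "a \<le> expectation f"
    by (simp add: prob_space)
  have "expectation f \<le> expectation (\<lambda>_. b)"
    by (intro integral_mono assms) simp
  thus "expectation f \<le> b"
    by (simp add: prob_space)
qed

lemma integrable_no_early_return: "integrable M (no_early_return m i)"
  by (rule integrable_bounded[where B = 1]) (auto simp: no_early_return_def)

text \<open>
  Two indicators whose indices differ by less than \<open>m\<close> have a covariance of at most 1. At the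
  distance \<open>r \<ge> m\<close> a gap of \<open>r - m\<close> steps separates the part of the path that determines the earlier
  indicator from the time of the later one, and the mixing of the internal states bounds the covariance by
  \<open>w (r - m)\<close>.
\<close>

lemma variance_truncated_le:
  assumes w: "\<And>r. 0 \<le> w r" "\<And>n. (\<Sum>r<n. w r) \<le> C"
    and mix: "\<And>f r. oscillation_le f 1 \<Longrightarrow> oscillation_le (state_average K r f) (w r)"
  shows "variance (\<lambda>\<omega>. \<Sum>i\<le>n. no_early_return m i \<omega>) \<le> 2 * (real n + 1) * (real m + C)"
proof -
  define e where "e i = expectation (no_early_return m i)" for i
  define Z where "Z i \<omega> = no_early_return m i \<omega> - e i" for i \<omega>
  define c where "c r = (if r < m then 1 else w (r - m))" for r
  have e: "0 \<le> e i" "e i \<le> 1" for i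
    using expectation_bounds[OF integrable_no_early_return no_early_return_bounds]
    by (simp_all add: e_def)
  have Z_bound: "\<bar>Z i \<omega>\<bar> \<le> 1" for i \<omega>
    using e[of i] no_early_return_bounds[of m i \<omega>] by (simp add: Z_def abs_le_iff)
  have Z_meas [measurable]: "Z i \<in> borel_measurable M" for i
    unfolding Z_def by measurable
  have ZZ_bound: "\<bar>Z i \<omega> * Z j \<omega>\<bar> \<le> 1" for i j \<omega>
    unfolding abs_mult using Z_bound by (intro mult_le_one) auto
  have ZZ_int: "integrable M (\<lambda>\<omega>. Z i \<omega> * Z j \<omega>)" for i j
    by (rule integrable_bounded[where B = 1]) (auto intro: ZZ_bound)
  have Z_int: "integrable M (Z i)" for i
    by (rule integrable_bounded[where B = 1]) (auto intro: Z_bound)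
  have Z_zero: "expectation (Z i) = 0" for i
    unfolding Z_def using integrable_no_early_return by (simp add: e_def prob_space)
  \<comment> \<open>For distant indices the later factor need not be centred, because the earlier one is.\<close>
  have pair: "expectation (\<lambda>\<omega>. Z i \<omega> * Z j \<omega>) \<le> c (j - i)" if "i \<le> j" for i j
  proof (cases "j - i < m")
    case True
    have "expectation (\<lambda>\<omega>. Z i \<omega> * Z j \<omega>) \<le> 1"
      using ZZ_bound by (intro expectation_bounds(2)[where a = "-1"] ZZ_int) (auto simp: abs_le_iff)
    thus ?thesis
      using True by (simp add: c_def)
  next
    case False
    define r where "r = j - i - m"
    have j: "j = (i + m) + r"
      using False that by (simp add: r_def)
    define \<phi> where "\<phi> h = of_bool (\<forall>k\<in>{i<..i + m}. fst (h ! k) \<noteq> fst (h ! i)) - e i"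
      for h :: "((int ^ 'd) \<times> 's) list"
    have \<phi>: "Z i \<omega> = \<phi> (history (i + m) \<omega>)" for \<omega>
      by (simp add: Z_def \<phi>_def no_early_return_history[OF order_refl])
    have "expectation (\<lambda>\<omega>. Z i \<omega> * Z j \<omega>)
        = expectation (\<lambda>\<omega>. Z i \<omega> * no_early_return m j \<omega> - e j * Z i \<omega>)"
      by (simp add: Z_def algebra_simps)
    also have "\<dots> = expectation (\<lambda>\<omega>. Z i \<omega> * no_early_return m j \<omega>) - e j * expectation (Z i)"
    proof (subst Bochner_Integration.integral_diff)
      show "integrable M (\<lambda>\<omega>. Z i \<omega> * no_early_return m j \<omega>)"
      proof (rule integrable_bounded[where B = 1])
        show "\<bar>Z i \<omega> * no_early_return m j \<omega>\<bar> \<le> 1" for \<omega>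
          unfolding abs_mult using Z_bound no_early_return_bounds[of m j \<omega>]
          by (intro mult_le_one) auto
      qed measurable
    qed (simp_all add: Z_int)
    also have "\<dots> = expectation (\<lambda>\<omega>. \<phi> (history (i + m) \<omega>) * no_early_return m (i + m + r) \<omega>)"
      by (simp add: Z_zero j \<phi>)
    also have "\<dots> \<le> w r"
    proof (rule covariance_no_early_return_le)
      show "\<bar>\<phi> h\<bar> \<le> 1" for h
        using e[of i] by (simp add: \<phi>_def)
      show "expectation (\<lambda>\<omega>. \<phi> (history (i + m) \<omega>)) = 0"
        using Z_zero[of i] by (simp add: \<phi>[abs_def])
    qed (rule mix)
    finally show ?thesis
      using False by (simp add: c_def r_def)
  qed
  have pair': "expectation (\<lambda>\<omega>. Z i \<omega> * Z j \<omega>) \<le> c (if i \<le> j then j - i else i - j)" for i j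
    using pair[of i j] pair[of j i] by (simp add: mult.commute)
  have c_nonneg: "0 \<le> c r" for r
    using w(1) by (simp add: c_def)
  have c_sum: "(\<Sum>r\<le>n. c r) \<le> real m + C"
  proof -
    have "(\<Sum>r\<le>n. c r) \<le> (\<Sum>r\<in>{..<m} \<union> {m..<m + Suc n}. c r)"
      using c_nonneg by (intro sum_mono2) auto
    also have "\<dots> = (\<Sum>r<m. c r) + (\<Sum>r\<in>{m..<m + Suc n}. c r)"
      by (intro sum.union_disjoint) auto
    also have "(\<Sum>r<m. c r) = real m"
      by (simp add: c_def)
    also have "(\<Sum>r\<in>{m..<m + Suc n}. c r) = (\<Sum>r<Suc n. w r)"
      by (rule sum.reindex_bij_witness[of _ "\<lambda>r. r + m" "\<lambda>r. r - m"]) (auto simp: c_def)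
    finally show ?thesis
      using w(2)[of "Suc n"] by linarith
  qed
  have "expectation (\<lambda>\<omega>. \<Sum>i\<le>n. no_early_return m i \<omega>) = (\<Sum>i\<le>n. e i)"
    unfolding e_def by (intro Bochner_Integration.integral_sum integrable_no_early_return)
  hence "variance (\<lambda>\<omega>. \<Sum>i\<le>n. no_early_return m i \<omega>)
      = expectation (\<lambda>\<omega>. \<Sum>i\<le>n. \<Sum>j\<le>n. Z i \<omega> * Z j \<omega>)"
    by (simp add: Z_def power2_eq_square sum_product flip: sum_subtractf)
  also have "\<dots> = (\<Sum>i\<le>n. \<Sum>j\<le>n. expectation (\<lambda>\<omega>. Z i \<omega> * Z j \<omega>))"
    by (simp add: Bochner_Integration.integral_sum ZZ_int)
  also have "\<dots> \<le> (\<Sum>i\<le>n. 2 * (\<Sum>r\<le>n. c r))"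
  proof (rule sum_mono)
    fix i assume "i \<in> {..n}"
    hence "(\<Sum>j\<le>n. c (if i \<le> j then j - i else i - j)) \<le> 2 * (\<Sum>r\<le>n. c r)"
      by (intro sum_differences_le c_nonneg) simp
    moreover have "(\<Sum>j\<le>n. expectation (\<lambda>\<omega>. Z i \<omega> * Z j \<omega>))
        \<le> (\<Sum>j\<le>n. c (if i \<le> j then j - i else i - j))"
      by (intro sum_mono pair')
    ultimately show "(\<Sum>j\<le>n. expectation (\<lambda>\<omega>. Z i \<omega> * Z j \<omega>)) \<le> 2 * (\<Sum>r\<le>n. c r)"
      by linarith
  qed
  also have "\<dots> = 2 * (real n + 1) * (\<Sum>r\<le>n. c r)"
    by simp
  also have "\<dots> \<le> 2 * (real n + 1) * (real m + C)"
    by (intro mult_left_mono c_sum) simp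
  finally show ?thesis .
qed

text \<open>
  The first term accounts for windows that reach beyond time \<open>n\<close>. For the others the two indicators differ
  only if the walk comes back after more than \<open>m\<close> steps.
\<close>

lemma truncation_error_le:
  "\<bar>no_early_return (n - i) i \<omega> - no_early_return m i \<omega>\<bar>
     \<le> of_bool (n < i + m) + (\<Sum>k\<in>{m<..n}. of_bool (fst (\<xi> (i + k) \<omega>) = fst (\<xi> i \<omega>)))"
  (is "_ \<le> _ + ?S")
proof -
  have S: "0 \<le> ?S"
    by (intro sum_nonneg) auto
  show ?thesis
  proof (cases "n < i + m \<or> no_early_return (n - i) i \<omega> = no_early_return m i \<omega>")
    case True
    moreover have "\<bar>no_early_return (n - i) i \<omega> - no_early_return m i \<omega>\<bar> \<le> 1"
      by (simp add: no_early_return_def)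
    ultimately show ?thesis
      using S by auto
  next
    case False
    hence "i + m \<le> n" and ne: "no_early_return (n - i) i \<omega> \<noteq> no_early_return m i \<omega>"
      by auto
    have "(\<forall>k\<in>{i<..n}. fst (\<xi> k \<omega>) \<noteq> fst (\<xi> i \<omega>))
        \<noteq> (\<forall>k\<in>{i<..i + m}. fst (\<xi> k \<omega>) \<noteq> fst (\<xi> i \<omega>))"
      using ne \<open>i + m \<le> n\<close> by (simp only: no_early_return_def of_bool_eq_iff) simp
    moreover have "{i<..i + m} \<subseteq> {i<..n}"
      using \<open>i + m \<le> n\<close> by auto
    ultimately obtain k where "k \<in> {i<..n} - {i<..i + m}" and "fst (\<xi> k \<omega>) = fst (\<xi> i \<omega>)"
      by blast
    hence k: "i + m < k" "k \<le> n" "fst (\<xi> k \<omega>) = fst (\<xi> i \<omega>)"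
      by auto
    have "(1::real) = of_bool (fst (\<xi> (i + (k - i)) \<omega>) = fst (\<xi> i \<omega>))"
      using k by simp
    also have "\<dots> \<le> ?S"
      using k by (intro member_le_sum[where f = "\<lambda>k. of_bool (fst (\<xi> (i + k) \<omega>) = fst (\<xi> i \<omega>))"]) auto
    finally have "1 \<le> ?S" .
    moreover have "\<bar>no_early_return (n - i) i \<omega> - no_early_return m i \<omega>\<bar> \<le> 1"
      by (simp add: no_early_return_def)
    ultimately show ?thesis
      by simp
  qed
qed

text \<open>
  Each of the \<open>n + 1\<close> differences is at most 1, so the square of their sum is at most \<open>n + 1\<close> times the
  sum of their absolute values; the expectation of the latter is bounded term by term.
\<close>

lemma expectation_truncation_error_squared_le:
  assumes b: "\<And>k x s. k > m \<Longrightarrow> measure (walk K k s) {s'. fst s' = x} \<le> b k"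
  shows "expectation (\<lambda>\<omega>. (\<Sum>i\<le>n. no_early_return (n - i) i \<omega> - no_early_return m i \<omega>)\<^sup>2)
     \<le> (real n + 1) * (real m + (real n + 1) * (\<Sum>k\<in>{m<..n}. b k))"
proof -
  define D where "D i \<omega> = \<bar>no_early_return (n - i) i \<omega> - no_early_return m i \<omega>\<bar>" for i \<omega>
  have D: "0 \<le> D i \<omega>" "D i \<omega> \<le> 1" for i \<omega>
    by (simp_all add: D_def no_early_return_def)
  have D_meas [measurable]: "D i \<in> borel_measurable M" for i
    unfolding D_def by measurable
  have D_int: "integrable M (D i)" for i
    by (rule integrable_bounded[where B = 1]) (use D in auto)
  have R_int: "integrable M (\<lambda>\<omega>. of_bool (fst (\<xi> (i + k) \<omega>) = fst (\<xi> i \<omega>)) :: real)" for i k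
  proof -
    have "integrable M (\<lambda>\<omega>. of_bool (fst (history (i + k) \<omega> ! (i + k)) = fst (history (i + k) \<omega> ! i)) :: real)"
      by (rule integrable_of_history[where B = 1]) simp
    thus ?thesis
      by (simp add: nth_history)
  qed
  have sum_le: "(\<Sum>i\<le>n. D i \<omega>) \<le> real n + 1" for \<omega>
    using sum_mono[of "{..n}" "\<lambda>i. D i \<omega>" "\<lambda>_. 1"] D by simp
  have sq_le: "(\<Sum>i\<le>n. no_early_return (n - i) i \<omega> - no_early_return m i \<omega>)\<^sup>2
      \<le> (real n + 1) * (\<Sum>i\<le>n. D i \<omega>)" for \<omega>
  proof -
    have "\<bar>\<Sum>i\<le>n. no_early_return (n - i) i \<omega> - no_early_return m i \<omega>\<bar> \<le> (\<Sum>i\<le>n. D i \<omega>)"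
      unfolding D_def by (rule sum_abs)
    hence "\<bar>\<Sum>i\<le>n. no_early_return (n - i) i \<omega> - no_early_return m i \<omega>\<bar>\<^sup>2 \<le> (\<Sum>i\<le>n. D i \<omega>)\<^sup>2"
      by (intro power_mono) auto
    also have "\<dots> \<le> (real n + 1) * (\<Sum>i\<le>n. D i \<omega>)"
      unfolding power2_eq_square using sum_le D by (intro mult_right_mono sum_nonneg) auto
    finally show ?thesis
      by simp
  qed
  have D_exp: "expectation (D i) \<le> of_bool (n < i + m) + (\<Sum>k\<in>{m<..n}. b k)" for i
  proof -
    have "expectation (D i) \<le> expectation (\<lambda>\<omega>. of_bool (n < i + m)
        + (\<Sum>k\<in>{m<..n}. of_bool (fst (\<xi> (i + k) \<omega>) = fst (\<xi> i \<omega>))))"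
      using truncation_error_le
      by (intro integral_mono D_int Bochner_Integration.integrable_add Bochner_Integration.integrable_sum R_int)
         (auto simp: D_def)
    also have "\<dots> = of_bool (n < i + m)
        + (\<Sum>k\<in>{m<..n}. expectation (\<lambda>\<omega>. of_bool (fst (\<xi> (i + k) \<omega>) = fst (\<xi> i \<omega>))))"
      using R_int by (simp add: Bochner_Integration.integral_sum prob_space del: sum_of_bool_eq)
    also have "\<dots> \<le> of_bool (n < i + m) + (\<Sum>k\<in>{m<..n}. b k)"
      by (intro add_left_mono sum_mono expectation_return_le b) auto
    finally show ?thesis .
  qed
  have boundary: "(\<Sum>i\<le>n. of_bool (n < i + m) :: real) \<le> real m"
  proof -
    have "(\<Sum>i\<le>n. of_bool (n < i + m) :: real) = real (card {i \<in> {..n}. n < i + m})"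
      by (simp add: Int_def)
    also have "card {i \<in> {..n}. n < i + m} \<le> card {Suc n - m..<Suc n}"
      by (intro card_mono) auto
    finally show ?thesis
      by simp
  qed
  have "expectation (\<lambda>\<omega>. (\<Sum>i\<le>n. no_early_return (n - i) i \<omega> - no_early_return m i \<omega>)\<^sup>2)
      \<le> expectation (\<lambda>\<omega>. (real n + 1) * (\<Sum>i\<le>n. D i \<omega>))"
  proof (rule integral_mono)
    show "integrable M (\<lambda>\<omega>. (real n + 1) * (\<Sum>i\<le>n. D i \<omega>))"
      using D_int by simp
    show "integrable M (\<lambda>\<omega>. (\<Sum>i\<le>n. no_early_return (n - i) i \<omega> - no_early_return m i \<omega>)\<^sup>2)"
    proof (rule integrable_bounded[where B = "(real n + 1) * (real n + 1)"])
      show "\<bar>(\<Sum>i\<le>n. no_early_return (n - i) i \<omega> - no_early_return m i \<omega>)\<^sup>2\<bar>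
          \<le> (real n + 1) * (real n + 1)" for \<omega>
        using order_trans[OF sq_le mult_left_mono[OF sum_le]] by simp
    qed measurable
  qed (rule sq_le)
  also have "\<dots> = (real n + 1) * (\<Sum>i\<le>n. expectation (D i))"
    using D_int by (simp add: Bochner_Integration.integral_sum)
  also have "\<dots> \<le> (real n + 1) * (\<Sum>i\<le>n. of_bool (n < i + m) + (\<Sum>k\<in>{m<..n}. b k))"
    by (intro mult_left_mono sum_mono D_exp) simp
  also have "\<dots> \<le> (real n + 1) * (real m + (real n + 1) * (\<Sum>k\<in>{m<..n}. b k))"
    using boundary
    by (intro mult_left_mono) (auto simp: sum.distrib algebra_simps simp del: sum_of_bool_eq)
  finally show ?thesis .
qed

lemma variance_sum_le:
  fixes X Y :: "'w \<Rightarrow> real"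
  assumes [measurable]: "X \<in> borel_measurable M" "Y \<in> borel_measurable M"
    and B: "\<And>\<omega>. \<bar>X \<omega>\<bar> \<le> B" "\<And>\<omega>. \<bar>Y \<omega>\<bar> \<le> B"
  shows "variance (\<lambda>\<omega>. X \<omega> + Y \<omega>) \<le> 2 * variance X + 2 * expectation (\<lambda>\<omega>. (Y \<omega>)\<^sup>2)"
proof -
  have int: "integrable M X" "integrable M Y"
    by (auto intro: integrable_bounded[where B = B] B)
  have sq: "integrable M (\<lambda>\<omega>. (Z \<omega> - c)\<^sup>2)"
    if [measurable]: "Z \<in> borel_measurable M" and Z: "\<And>\<omega>. \<bar>Z \<omega>\<bar> \<le> B" for Z :: "'w \<Rightarrow> real" and c :: real
  proof (rule integrable_bounded[where B = "(B + \<bar>c\<bar>)\<^sup>2"])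
    show "\<bar>(Z \<omega> - c)\<^sup>2\<bar> \<le> (B + \<bar>c\<bar>)\<^sup>2" for \<omega>
      using Z[of \<omega>] by (simp add: abs_le_square_iff[symmetric])
  qed measurable
  have Y2: "integrable M (\<lambda>\<omega>. (Y \<omega>)\<^sup>2)"
    using sq[of Y 0, OF assms(2) B(2)] by simp
  have "variance (\<lambda>\<omega>. X \<omega> + Y \<omega>)
      = expectation (\<lambda>\<omega>. ((X \<omega> - expectation X) + (Y \<omega> - expectation Y))\<^sup>2)"
    using int by (simp add: algebra_simps)
  also have "\<dots> \<le> expectation (\<lambda>\<omega>. 2 * (X \<omega> - expectation X)\<^sup>2 + 2 * (Y \<omega> - expectation Y)\<^sup>2)"
  proof (rule integral_mono)
    show "integrable M (\<lambda>\<omega>. ((X \<omega> - expectation X) + (Y \<omega> - expectation Y))\<^sup>2)"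
    proof (rule integrable_bounded[where B = "(2 * B + \<bar>expectation X\<bar> + \<bar>expectation Y\<bar>)\<^sup>2"])
      show "\<bar>((X \<omega> - expectation X) + (Y \<omega> - expectation Y))\<^sup>2\<bar>
          \<le> (2 * B + \<bar>expectation X\<bar> + \<bar>expectation Y\<bar>)\<^sup>2" for \<omega>
        using B[of \<omega>] by (simp add: abs_le_square_iff[symmetric])
    qed measurable
    show "((X \<omega> - expectation X) + (Y \<omega> - expectation Y))\<^sup>2
        \<le> 2 * (X \<omega> - expectation X)\<^sup>2 + 2 * (Y \<omega> - expectation Y)\<^sup>2" for \<omega>
      using zero_le_power2[of "(X \<omega> - expectation X) - (Y \<omega> - expectation Y)"]
      by (simp add: power2_sum power2_diff)
  qed (use sq[OF assms(1) B(1)] sq[OF assms(2) B(2)] in simp)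
  also have "\<dots> = 2 * variance X + 2 * variance Y"
    using sq[OF assms(1) B(1)] sq[OF assms(2) B(2)] by simp
  also have "variance Y \<le> expectation (\<lambda>\<omega>. (Y \<omega>)\<^sup>2)"
    using int(2) Y2 by (subst variance_eq) auto
  finally show ?thesis
    by simp
qed

lemma variance_visited_sites_le:
  assumes w: "\<And>r. 0 \<le> w r" "\<And>n. (\<Sum>r<n. w r) \<le> C"
    and mix: "\<And>f r. oscillation_le f 1 \<Longrightarrow> oscillation_le (state_average K r f) (w r)"
    and b: "\<And>k x s. k > m \<Longrightarrow> measure (walk K k s) {s'. fst s' = x} \<le> b k"
  shows "variance (\<lambda>\<omega>. real (visited_sites \<xi> n \<omega>))
    \<le> 2 * (2 * (real n + 1) * (real m + C))
      + 2 * ((real n + 1) * (real m + (real n + 1) * (\<Sum>k\<in>{m<..n}. b k)))"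
proof -
  let ?X = "\<lambda>\<omega>. \<Sum>i\<le>n. no_early_return m i \<omega>"
  let ?Y = "\<lambda>\<omega>. \<Sum>i\<le>n. no_early_return (n - i) i \<omega> - no_early_return m i \<omega>"
  have "\<bar>?X \<omega>\<bar> \<le> real n + 1" for \<omega>
    using sum_mono[of "{..n}" "\<lambda>i. no_early_return m i \<omega>" "\<lambda>_. 1"] no_early_return_bounds
    by (simp add: abs_of_nonneg sum_nonneg)
  moreover have "\<bar>?Y \<omega>\<bar> \<le> real n + 1" for \<omega>
  proof -
    have "\<bar>?Y \<omega>\<bar> \<le> (\<Sum>i\<le>n. \<bar>no_early_return (n - i) i \<omega> - no_early_return m i \<omega>\<bar>)"
      by (rule sum_abs)
    also have "\<dots> \<le> (\<Sum>i\<le>n. 1)"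
      by (intro sum_mono) (simp add: no_early_return_def)
    finally show ?thesis
      by simp
  qed
  ultimately have "variance (\<lambda>\<omega>. ?X \<omega> + ?Y \<omega>)
      \<le> 2 * variance ?X + 2 * expectation (\<lambda>\<omega>. (?Y \<omega>)\<^sup>2)"
    by (intro variance_sum_le[where B = "real n + 1"]) measurable
  moreover have "real (visited_sites \<xi> n \<omega>) = ?X \<omega> + ?Y \<omega>" for \<omega>
    by (simp add: visited_sites_eq_sum sum_subtractf)
  ultimately have "variance (\<lambda>\<omega>. real (visited_sites \<xi> n \<omega>))
      \<le> 2 * variance ?X + 2 * expectation (\<lambda>\<omega>. (?Y \<omega>)\<^sup>2)"
    by (simp only:)
  also have "\<dots> \<le> 2 * (2 * (real n + 1) * (real m + C))
      + 2 * ((real n + 1) * (real m + (real n + 1) * (\<Sum>k\<in>{m<..n}. b k)))"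
    by (intro add_mono mult_left_mono variance_truncated_le[OF w mix]
        expectation_truncation_error_squared_le b) auto
  finally show ?thesis .
qed

end

text \<open>
  Comparison with the integral of \<open>x powr - s\<close>, carried out as a telescoping sum by the mean value theorem.
\<close>

lemma sum_powr_tail_le:
  fixes s :: real
  assumes "s > 1" "m \<ge> 1"
  shows "(\<Sum>k\<in>{m<..n}. real k powr - s) \<le> real m powr (1 - s) / (s - 1)"
proof (cases "m \<le> n")
  case True
  have "(\<Sum>k\<in>{m<..n}. real k powr - s) \<le> (real m powr (1 - s) - real n powr (1 - s)) / (s - 1)"
    using True
  proof (induction n rule: dec_induct)
    case base
    show ?case by simp
  next
    case (step n)
    have "\<exists>z. real n < z \<and> z < real (Suc n) \<and>
        real (Suc n) powr (1 - s) - real n powr (1 - s)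
          = (real (Suc n) - real n) * ((1 - s) * z powr (1 - s - 1))"
    proof (rule MVT2)
      show "((\<lambda>x. x powr (1 - s)) has_real_derivative (1 - s) * x powr (1 - s - 1)) (at x)"
        if "real n \<le> x" for x
        using that step.hyps assms by (intro has_real_derivative_powr) auto
    qed simp
    then obtain z where z: "real n < z" "z < real (Suc n)"
      "real n powr (1 - s) - real (Suc n) powr (1 - s) = (s - 1) * z powr - s"
      by (auto simp: algebra_simps)
    have "real (Suc n) powr - s \<le> z powr - s"
      using z step.hyps assms by (intro powr_mono2') auto
    hence "(s - 1) * real (Suc n) powr - s \<le> real n powr (1 - s) - real (Suc n) powr (1 - s)"
      using z(3) assms by simp
    hence "real (Suc n) powr - s \<le> (real n powr (1 - s) - real (Suc n) powr (1 - s)) / (s - 1)"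
      using assms by (simp add: field_simps)
    moreover have "{m<..Suc n} = insert (Suc n) {m<..n}"
      using step.hyps by auto
    ultimately show ?case
      using step.IH by (simp add: diff_divide_distrib)
  qed
  also have "\<dots> \<le> real m powr (1 - s) / (s - 1)"
    using assms by (intro divide_right_mono) auto
  finally show ?thesis .
qed (use assms in auto)

section \<open>The step law of a kernel\<close>

text \<open>
  The nonnegative family \<open>p y j k\<close> has the sum 1 over \<open>(y, k)\<close>, so \<open>embed_pmf\<close>
  really returns the law with these point masses.
\<close>

definition step_law :: "('d::finite, 's::finite) kernel \<Rightarrow> 's \<Rightarrow> ((int ^ 'd) \<times> 's) pmf" where
  "step_law p j = embed_pmf (\<lambda>(y, k). p y j k)"

lemma pmf_step_law:
  assumes "rwwis_kernel p"
  shows "pmf (step_law p j) (y, k) = p y j k"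
proof -
  let ?f = "\<lambda>(y, k). p y j k"
  have nonneg: "0 \<le> ?f x" for x
    using assms by (auto simp: rwwis_kernel_def split: prod.splits)
  have sum: "(?f has_sum 1) UNIV"
    using assms by (auto simp: rwwis_kernel_def)
  have "(\<lambda>x. norm (?f x)) summable_on UNIV"
    using sum nonneg by (auto simp: has_sum_imp_summable)
  hence abs: "Infinite_Set_Sum.abs_summable_on ?f UNIV"
    by (simp only: abs_summable_equivalent)
  have "(\<integral>\<^sup>+x. ennreal (?f x) \<partial>count_space UNIV) = ennreal (\<integral>x. ?f x \<partial>count_space UNIV)"
    using abs nonneg by (intro nn_integral_eq_integral) (auto simp: Infinite_Set_Sum.abs_summable_on_def)
  also have "(\<integral>x. ?f x \<partial>count_space UNIV) = infsum ?f UNIV"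
    using infsetsum_infsum[OF abs] by (simp add: infsetsum_def)
  also have "\<dots> = 1"
    using sum by (rule infsumI)
  finally have "(\<integral>\<^sup>+x. ennreal (?f x) \<partial>count_space UNIV) = 1"
    by simp
  from pmf_embed_pmf[OF nonneg this, of "(y, k)"] show ?thesis
    by (simp add: step_law_def)
qed

lemma pmf_jump:
  fixes K :: "'s \<Rightarrow> ((int ^ 'd::finite) \<times> 's) pmf"
  shows "pmf (jump K s) (x, k) = pmf (K (snd s)) (x - fst s, k)"
proof -
  have "inj (translate (fst s) :: (int ^ 'd) \<times> 's \<Rightarrow> _)"
    by (auto simp: inj_def translate_def prod_eq_iff)
  from pmf_map_inj'[OF this, of "K (snd s)" "(x - fst s, k)"] show ?thesis
    by (simp add: jump_def translate_def)
qed

lemma pmf_walk_step_law: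
  fixes p :: "('d::finite, 's::finite) kernel"
  assumes "rwwis_kernel p"
  shows "pmf (walk (step_law p) n (0, j)) (y, k) = step_prob p n y j k"
proof (induction n arbitrary: y k)
  case 0
  then show ?case
    by (auto simp: indicator_def)
next
  case (Suc n)
  let ?P = "walk (step_law p) n (0, j)"
  let ?f = "\<lambda>s. pmf ?P s * p (y - fst s) (snd s) k"
  have "pmf (walk (step_law p) (Suc n) (0, j)) (y, k) = (\<integral>s. p (y - fst s) (snd s) k \<partial>?P)"
    by (simp add: pmf_bind pmf_jump pmf_step_law[OF assms])
  also have "\<dots> = infsetsum ?f UNIV"
    by (rule pmf_expectation_eq_infsetsum)
  also have "\<dots> = infsum ?f UNIV"
  proof (rule infsetsum_infsum, rule abs_summable_on_comparison_test)
    show "Infinite_Set_Sum.abs_summable_on (pmf ?P) UNIV"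
      by (rule pmf_abs_summable)
    show "norm (?f s) \<le> norm (pmf ?P s)" for s
      by (simp add: abs_mult mult_left_le pmf_le_1 flip: pmf_step_law[OF assms])
  qed
  also have "\<dots> = step_prob p (Suc n) y j k"
    by (simp add: case_prod_beta' flip: Suc.IH)
  finally show ?case .
qed

lemma leads_to_iff_step_prob:
  assumes "rwwis_kernel p"
  shows "leads_to (step_law p) n i x j \<longleftrightarrow> step_prob p n x i j > 0"
  unfolding leads_to_def set_pmf_iff pmf_walk_step_law[OF assms, symmetric]
  using pmf_nonneg[of "walk (step_law p) n (0, i)" "(x, j)"] by linarith

lemma Q_mat_nonzero_imp_jump:
  fixes p :: "('d::finite, 's::finite) kernel"
  assumes "Q_mat p $ j $ k \<noteq> 0"
  obtains y where "p y j k \<noteq> 0"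
proof -
  have lin: "bounded_linear (\<lambda>B::real ^ 's ^ 's. B $ j $ k)"
    by (intro bounded_linear_compose[OF bounded_linear_vec_nth bounded_linear_vec_nth])
  have "\<exists>y. p y j k \<noteq> 0"
  proof (rule ccontr)
    assume "\<nexists>y. p y j k \<noteq> 0"
    hence zero: "A_mat p y $ j $ k = 0" for y
      by (simp add: A_mat_def)
    have "Q_mat p $ j $ k = 0"
    proof (cases "A_mat p summable_on UNIV")
      case True
      hence "(A_mat p has_sum Q_mat p) UNIV"
        unfolding Q_mat_def by (rule has_sum_infsum)
      from has_sum_bounded_linear[OF lin this] have "((\<lambda>_. 0) has_sum Q_mat p $ j $ k) (UNIV :: (int ^ 'd) set)"
        by (simp add: zero o_def)
      thus ?thesis
        by (rule has_sum_unique) (simp add: has_sum_0)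
    next
      case False
      thus ?thesis
        by (simp add: Q_mat_def infsum_not_exists)
    qed
    with assms show False
      by simp
  qed
  with that show thesis
    by blast
qed

text \<open>
  A nonzero entry of \<open>Q ^ n\<close> contains a nonzero product of entries of \<open>Q\<close>, hence a path of
  \<open>n\<close> possible jumps.
\<close>

lemma matrix_power_nonzero_imp_leads_to:
  fixes p :: "('d::finite, 's::finite) kernel"
  assumes "rwwis_kernel p" "matrix_power (Q_mat p) n $ j $ k \<noteq> 0"
  shows "\<exists>x. leads_to (step_law p) n j x k"
  using assms(2)
proof (induction n arbitrary: j)
  case 0
  hence "j = k"
    by (auto simp: matrix_power_def mat_def split: if_splits)
  thus ?case
    by (auto simp: leads_to_def)
next
  case (Suc n)
  have "(\<Sum>l\<in>UNIV. Q_mat p $ j $ l * matrix_power (Q_mat p) n $ l $ k) \<noteq> 0"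
    using Suc.prems by (simp add: matrix_power_def matrix_matrix_mult_def)
  then obtain l where l: "Q_mat p $ j $ l * matrix_power (Q_mat p) n $ l $ k \<noteq> 0"
    by (meson sum.not_neutral_contains_not_neutral)
  then obtain y where "p y j l \<noteq> 0"
    using Q_mat_nonzero_imp_jump by (metis mult_zero_left)
  hence "leads_to (step_law p) 1 j y l"
    by (simp add: leads_to_def bind_return_pmf set_pmf_iff pmf_jump pmf_step_law[OF assms(1)])
  moreover obtain x where "leads_to (step_law p) n l x k"
    using l Suc.IH[of l] by auto
  ultimately show ?case
    using leads_to_add by fastforce
qed

lemma rwwis_imp_internal_state_walk:
  assumes kernel: "rwwis_kernel p" and walk: "rwwis p M \<xi>"
  shows "internal_state_walk M (step_law p) \<xi>"
proof -
  interpret prob_space M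
    using walk by (simp add: rwwis_def)
  show ?thesis
  proof
    show "\<xi> n \<in> M \<rightarrow>\<^sub>M count_space UNIV" for n
      using walk by (simp add: rwwis_def)
    show "\<P>(\<omega> in M. \<xi> (Suc n) \<omega> = s \<bar> \<forall>i\<le>n. \<xi> i \<omega> = h i) = pmf (jump (step_law p) (h n)) s"
      if "0 < \<P>(\<omega> in M. \<forall>i\<le>n. \<xi> i \<omega> = h i)" for n h s
      using walk that by (cases s) (auto simp: rwwis_def pmf_jump pmf_step_law[OF kernel])
  qed
qed

text \<open>
  Every time at which \<open>Q ^ n\<close> has a positive diagonal entry is the length of a loop, so the loop
  lengths have greatest common divisor 1 as well.
\<close>

lemma eventually_leads_to_step_law:
  fixes p :: "('d::finite, 's::finite) kernel"
  assumes kernel: "rwwis_kernel p"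
    and irreducible: "irreducible_matrix (Q_mat p)"
    and aperiodic: "aperiodic_matrix (Q_mat p)"
  shows "\<forall>\<^sub>F n in sequentially. \<forall>i j. \<exists>x. leads_to (step_law p) n i x j"
proof (rule eventually_leads_to)
  show "\<exists>n x. leads_to (step_law p) n i x j" for i j
    using irreducible matrix_power_nonzero_imp_leads_to[OF kernel]
    unfolding irreducible_matrix_def by (metis less_irrefl)
  show "Gcd {n. n \<ge> 1 \<and> (\<exists>x. leads_to (step_law p) n j x j)} = 1" for j
  proof -
    have "Gcd {n. n \<ge> 1 \<and> (\<exists>x. leads_to (step_law p) n j x j)}
        dvd Gcd {n. n \<ge> 1 \<and> matrix_power (Q_mat p) n $ j $ j > 0}"
      using matrix_power_nonzero_imp_leads_to[OF kernel]
      by (intro Gcd_greatest Gcd_dvd) fastforce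
    thus ?thesis
      using aperiodic by (simp add: aperiodic_matrix_def)
  qed
qed

lemma resolves_step_law:
  fixes p :: "('d::finite, 's::finite) kernel"
  assumes kernel: "rwwis_kernel p" and arithmetic: "trivial_arithmetic p"
    and mix: "\<forall>\<^sub>F n in sequentially. \<forall>i j. \<exists>x. leads_to (step_law p) n i x j"
  shows "resolves (step_law p) z"
proof -
  obtain j :: 's where True by blast
  let ?S = "{y - y' | y y'. \<exists>n\<ge>1. step_prob p n y j j > 0 \<and> step_prob p n y' j j > 0}"
  have "resolves (step_law p) z" if "z \<in> ?S" for z
    using that resolves_loop_difference[OF mix] by (auto simp: leads_to_iff_step_prob[OF kernel])
  moreover have "z \<in> group_closure ?S"
    using arithmetic by (simp add: trivial_arithmetic_def)
  ultimately show ?thesis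
    by (rule resolves_group_closure)
qed

section \<open>Growth of the variance\<close>

theorem theorem4:
  fixes p :: "('d::finite, 's::finite) kernel"
    and \<mu> :: "real ^ 's"
    and M :: "'w measure"
    and \<xi> :: "nat \<Rightarrow> 'w \<Rightarrow> (int ^ 'd) \<times> 's"
  assumes dim: "CARD('d) \<ge> 3"
    and kernel: "rwwis_kernel p"
    and irreducible: "irreducible_matrix (Q_mat p)"
    and aperiodic: "aperiodic_matrix (Q_mat p)"
    and stationary: "stationary_distribution (Q_mat p) \<mu>"
    and arithmetic: "trivial_arithmetic p"
    and mean: "zero_mean p \<mu>"
    and moments: "finite_second_moments p"
    and nonsingular: "invertible (covariance_matrix p \<mu>)"
    and walk: "rwwis p M \<xi>"
    and initial: "\<And>j. \<P>(\<omega> in M. snd (\<xi> 0 \<omega>) = j) = \<mu> $ j"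
  shows "(\<lambda>n. prob_space.variance M (\<lambda>\<omega>. real (visited_sites \<xi> n \<omega>)))
           \<in> O(\<lambda>n. real n powr (1 + 2 / real CARD('d)))"
proof -
  let ?K = "step_law p" and ?d = "real CARD('d)"
  have mixing: "\<forall>\<^sub>F n in sequentially. \<forall>i j. \<exists>x. leads_to ?K n i x j"
    by (rule eventually_leads_to_step_law[OF kernel irreducible aperiodic])
  obtain w :: "nat \<Rightarrow> real" and C where w: "\<And>r. 0 \<le> w r" "\<And>n. (\<Sum>r<n. w r) \<le> C"
    and rate: "\<And>f r. oscillation_le f 1 \<Longrightarrow> oscillation_le (state_average ?K r f) (w r)"
    using mixing_rate[OF mixing] by blast
  have "C \<ge> 0"
    using w(2)[of 0] by simp
  obtain C0 where C0: "\<And>n x s. n \<ge> 1 \<Longrightarrow>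
      measure (walk ?K n s) {s'. fst s' = x} \<le> C0 * real n powr - (?d / 2)"
    using local_limit_upper_bound[OF resolves_step_law[OF kernel arithmetic mixing]] by blast
  have "C0 \<ge> 0"
    using order_trans[OF measure_nonneg C0[of 1]] by simp
  define s where "s = ?d / 2"
  have "s > 1"
    using dim by (simp add: s_def)
  define C1 where "C1 = C0 / (s - 1)"
  have "C1 \<ge> 0"
    using \<open>C0 \<ge> 0\<close> \<open>s > 1\<close> by (simp add: C1_def)
  interpret internal_state_walk M ?K \<xi>
    by (rule rwwis_imp_internal_state_walk[OF kernel walk])
  have bound: "variance (\<lambda>\<omega>. real (visited_sites \<xi> n \<omega>))
      \<le> (24 + 8 * C + 8 * C1) * real n powr (1 + 2 / ?d)" if n: "n \<ge> 1" for n
  proof -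
    define P where "P = real n powr (2 / ?d)"
    \<comment> \<open>The window length at which \<open>n m\<close> and \<open>n^2 m^(1-d/2)\<close> have the same order.\<close>
    define m where "m = nat \<lceil>P\<rceil>"
    have "P \<ge> 1"
      using n by (simp add: P_def ge_one_powr_ge_zero)
    hence m: "P \<le> real m" "real m \<le> 2 * P" "m \<ge> 1"
      unfolding m_def by linarith+
    define T where "T = (\<Sum>k\<in>{m<..n}. C0 * real k powr - s)"
    have "T = C0 * (\<Sum>k\<in>{m<..n}. real k powr - s)"
      by (simp add: T_def sum_distrib_left)
    also have "\<dots> \<le> C0 * (real m powr (1 - s) / (s - 1))"
      using sum_powr_tail_le[OF \<open>s > 1\<close> m(3)] \<open>C0 \<ge> 0\<close> by (rule mult_left_mono)
    also have "\<dots> \<le> C0 * (P powr (1 - s) / (s - 1))"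
      using m(1) \<open>P \<ge> 1\<close> \<open>s > 1\<close> \<open>C0 \<ge> 0\<close>
      by (intro mult_left_mono divide_right_mono powr_mono2') auto
    also have "P powr (1 - s) = P / real n"
    proof -
      have "2 / ?d * (1 - s) = 2 / ?d - 1"
        by (simp add: s_def field_simps)
      hence "P powr (1 - s) = real n powr (2 / ?d - 1)"
        unfolding P_def powr_powr by (simp only:)
      also have "\<dots> = P / real n"
        using n by (simp add: P_def powr_diff)
      finally show ?thesis .
    qed
    finally have T: "T \<le> C1 * P / real n"
      by (simp add: C1_def mult_ac)
    have "(real n + 1) * T \<le> (2 * real n) * (C1 * P / real n)"
      using n T \<open>C1 \<ge> 0\<close> \<open>P \<ge> 1\<close> \<open>C0 \<ge> 0\<close>
      by (intro mult_mono) (auto simp: T_def intro!: sum_nonneg)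
    hence T': "(real n + 1) * T \<le> 2 * C1 * P"
      using n by simp
    have "C \<le> C * P"
      using \<open>C \<ge> 0\<close> \<open>P \<ge> 1\<close> by (simp add: mult_le_cancel_left1)
    have "0 \<le> T"
      unfolding T_def using \<open>C0 \<ge> 0\<close> by (intro sum_nonneg) simp
    have first: "(real n + 1) * (real m + C) \<le> (2 * real n) * (2 * P + C * P)"
      using n m(2) \<open>C \<le> C * P\<close> \<open>C \<ge> 0\<close> by (intro mult_mono) auto
    have second: "(real n + 1) * (real m + (real n + 1) * T) \<le> (2 * real n) * (2 * P + 2 * C1 * P)"
    proof (rule mult_mono)
      show "real m + (real n + 1) * T \<le> 2 * P + 2 * C1 * P"
        using m(2) T' by linarith
    qed (use n \<open>0 \<le> T\<close> in auto)
    have "variance (\<lambda>\<omega>. real (visited_sites \<xi> n \<omega>))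
        \<le> 2 * (2 * (real n + 1) * (real m + C)) + 2 * ((real n + 1) * (real m + (real n + 1) * T))"
      unfolding T_def s_def
      by (rule variance_visited_sites_le[OF w rate C0]) (use m(3) in auto)
    also have "\<dots> \<le> 2 * (2 * ((2 * real n) * (2 * P + C * P))) + 2 * ((2 * real n) * (2 * P + 2 * C1 * P))"
      using first second by linarith
    also have "\<dots> = (24 + 8 * C + 8 * C1) * (real n * P)"
      by (simp add: algebra_simps)
    also have "real n * P = real n powr (1 + 2 / ?d)"
      using n by (simp add: P_def powr_add)
    finally show ?thesis .
  qed
  show ?thesis
  proof (rule bigoI)
    show "\<forall>\<^sub>F n in sequentially. norm (variance (\<lambda>\<omega>. real (visited_sites \<xi> n \<omega>)))
        \<le> (24 + 8 * C + 8 * C1) * norm (real n powr (1 + 2 / ?d))"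
      using bound variance_positive
      by (intro eventually_sequentiallyI[of 1]) (simp add: abs_of_nonneg)
  qed
qed

end
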